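(* Let $h\le1/7$, let $\mathcal{A}^n_{h\tau}=(a^{h\tau}_{i,j})$ be the coefficient matrix defined in the context, and let $\mathcal{P}_{FC}$ be the modified interpolation of the context, all of whose nonzero entries equal $1/2$. For a given C/F splitting, suppose that one of the following two classes of conditions holds, where $\beta_0$ is the unique root in $(0,1/2)$ of $3^{3-2\beta}-2^{5-2\beta}+7=0$: (Class 1) $\beta\ge\beta_0$ and $$\frac{\tau_n^{\alpha_0}}{h^{2\gamma}}>-\frac{4\cos(\gamma\pi)\Gamma(4-2\gamma)}{3K_2(3^{3-2\gamma}-2^{5-2\gamma}+7)}\sum_{i=0}^s\frac{a_i}{\Gamma(3-\alpha_i)};\qquad(\ast)$$ (Class 2) $\beta<\beta_0$, $h$ is suitably small in the sense that $$h^{2(\gamma-\beta)}<-\frac12\,\frac{K_2(3^{3-2\gamma}-2^{5-2\gamma}+7)}{\cos(\gamma\pi)\Gamma(4-2\gamma)}\cdot\frac{\cos(\beta\pi)\Gamma(4-2\beta)}{K_1(3^{3-2\beta}-2^{5-2\beta}+7)},$$ and $(\ast)$ holds for the given $\tau_n$. Then there exists a constant $\sigma_2\ge1$, independent of the step sizes $\tau_n$ and $h$, such that the accuracy property $$\|e_F-\mathcal{P}_{FC}e_C\|_{0,F}^2\le\sigma_2\|e_h\|_1^2$$ holds for all $e_h=(e_F^T,e_C^T)^T=(e_1,e_2,\dots,e_{M-1})^T\in\mathbb{R}^{M-1}$.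
   Context: Parameters: orders $0<\alpha_s<\cdots<\alpha_1<\alpha_0<1$, $\beta\in(0,1/2)$, $\gamma\in(1/2,1)$, constants $a_0>0$, $a_i\ge0$ ($i=1,\dots,s$), $K_1>0$, $K_2>0$; a bounded interval $(a,b)$ divided into $M$ equal subintervals of length $h=(b-a)/M$; and the step size $\tau_n=t_n-t_{n-1}>0$ of a temporal mesh $0=t_0<t_1<\cdots<t_N=T$. The coefficient matrix is $$\mathcal{A}^n_{h\tau}=\sum_{i=0}^s a_i\frac{\Gamma(3-\alpha_0)\tau_n^{\alpha_0-\alpha_i}}{\Gamma(3-\alpha_i)}M_h+K_1\frac{\Gamma(3-\alpha_0)\tau_n^{\alpha_0}}{2}A_h^\beta+K_2\frac{\Gamma(3-\alpha_0)\tau_n^{\alpha_0}}{2}A_h^\gamma,$$ where $M_h$ is the $(M-1)\times(M-1)$ tridiagonal matrix with diagonal entries $4h/6$ and sub/superdiagonal entries $h/6$, and, for $\mu\in\{\beta,\gamma\}$, $A_h^\mu=(a^{\mu,h}_{i,j})_{(M-1)\times(M-1)}$ is the symmetric Toeplitz matrix with $$a^{\mu,h}_{i,i}=\frac{h^{1-2\mu}(2^{4-2\mu}-8)}{2\cos(\mu\pi)\Gamma(4-2\mu)},\qquad a^{\mu,h}_{j,j+1}=a^{\mu,h}_{j+1,j}=\frac{h^{1-2\mu}(3^{3-2\mu}-2^{5-2\mu}+7)}{2\cos(\mu\pi)\Gamma(4-2\mu)},$$ and, for $l\ge2$, $$a^{\mu,h}_{k,k+l}=a^{\mu,h}_{k+l,k}=\frac{h^{1-2\mu}}{2\cos(\mu\pi)\Gamma(4-2\mu)}\big[(l+2)^{3-2\mu}-4(l+1)^{3-2\mu}+6l^{3-2\mu}-4(l-1)^{3-2\mu}+(l-2)^{3-2\mu}\big].$$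 Classical algebraic multigrid (AMG) setting. A C/F splitting is a disjoint decomposition $\{1,\dots,M-1\}=C\cup F$ into coarse (C) and fine (F) variables. The strength-of-connection tolerance, which decides which variables count as strongly connected ($i$ depends strongly on $j\ne i$ if $-a^{h\tau}_{i,j}\ge\theta\max_{k\ne i}(-a^{h\tau}_{i,k})$), is chosen as $\theta=a^{h\tau}_{1,3}/a^{h\tau}_{1,2}+\epsilon_0$ with $\epsilon_0$ some small number. For $i\in F$, $P_i\subset C$ denotes the resulting set of interpolatory variables of $i$ (the C-variables on which $i$ depends strongly). The modified interpolation $\mathcal{P}_{FC}$ has all its nonzero entries equal to $1/2$, that is, $$(\mathcal{P}_{FC}e_C)_i=\sum_{k\in P_i}\tfrac12 e_k,\qquad i\in F.$$ Norms: for $v=(v_F,v_C)^T\in\mathbb{R}^{M-1}$ (F-variables ordered first, $\mathcal{A}_{FF}$ the corresponding diagonal block of $\mathcal{A}^n_{h\tau}$), $\|v_F\|_{0,F}=(\mathrm{diag}(\mathcal{A}_{FF})v_F,v_F)^{1/2}$ and $\|v\|_1=(\mathcal{A}^n_{h\tau}v,v)^{1/2}$.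
   Formalization: The C/F splitting must also satisfy the first Ruge–Stüben criterion (each strong dependency of an F-variable i is in C or depends strongly on a variable of P_i); for arbitrary splittings, e.g. C empty, no h-independent constant exists. ε0 is positive and below a step-size-independent threshold. *)

theory Defs
  imports "HOL-Analysis.Analysis"
begin

text \<open>
  Matrices and vectors of varying size \<open>m = M - 1\<close> are functions on \<open>nat\<close> of which only the
  values at indices in \<open>{1..m}\<close> are used, so that indices agree with the usual 1-based ones.
\<close>

definition nbr_coeff :: "real \<Rightarrow> real" where
  "nbr_coeff \<mu> = 3 powr (3 - 2 * \<mu>) - 2 powr (5 - 2 * \<mu>) + 7"

text \<open>For \<open>l = 2\<close> the last term is \<open>0 powr (3 - 2 * \<mu>) = 0\<close>, the intended value as \<open>\<mu> < 3/2\<close>.\<close>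

definition frac_stencil :: "real \<Rightarrow> nat \<Rightarrow> real" where
  "frac_stencil \<mu> l =
     (if l = 0 then 2 powr (4 - 2 * \<mu>) - 8
      else if l = 1 then nbr_coeff \<mu>
      else (real l + 2) powr (3 - 2 * \<mu>) - 4 * (real l + 1) powr (3 - 2 * \<mu>)
           + 6 * real l powr (3 - 2 * \<mu>)
           - 4 * (real l - 1) powr (3 - 2 * \<mu>) + (real l - 2) powr (3 - 2 * \<mu>))"

definition frac_stiffness :: "real \<Rightarrow> real \<Rightarrow> nat \<Rightarrow> nat \<Rightarrow> real" where
  "frac_stiffness \<mu> h i j =
     h powr (1 - 2 * \<mu>) / (2 * cos (\<mu> * pi) * Gamma (4 - 2 * \<mu>))
       * frac_stencil \<mu> (nat \<bar>int i - int j\<bar>)"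

definition mass :: "real \<Rightarrow> nat \<Rightarrow> nat \<Rightarrow> real" where
  "mass h i j = (if i = j then 4 * h / 6 else if i = Suc j \<or> j = Suc i then h / 6 else 0)"

definition coeff_matrix ::
  "nat \<Rightarrow> (nat \<Rightarrow> real) \<Rightarrow> (nat \<Rightarrow> real) \<Rightarrow> real \<Rightarrow> real \<Rightarrow> real \<Rightarrow> real
     \<Rightarrow> real \<Rightarrow> real \<Rightarrow> nat \<Rightarrow> nat \<Rightarrow> real" where
  "coeff_matrix s \<alpha> a \<beta> \<gamma> K1 K2 \<tau> h i j =
     (\<Sum>r=0..s. a r * (Gamma (3 - \<alpha> 0) * \<tau> powr (\<alpha> 0 - \<alpha> r) / Gamma (3 - \<alpha> r))) * mass h i j
     + K1 * (Gamma (3 - \<alpha> 0) * \<tau> powr \<alpha> 0 / 2) * frac_stiffness \<beta> h i j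
     + K2 * (Gamma (3 - \<alpha> 0) * \<tau> powr \<alpha> 0 / 2) * frac_stiffness \<gamma> h i j"

definition temporal_mesh :: "real \<Rightarrow> nat \<Rightarrow> (nat \<Rightarrow> real) \<Rightarrow> bool" where
  "temporal_mesh T N t \<longleftrightarrow> t 0 = 0 \<and> t N = T \<and> (\<forall>n\<in>{1..N}. t (n - 1) < t n)"

text \<open>The point \<open>1/2\<close> is itself a zero of \<open>nbr_coeff\<close>, hence the open interval below.\<close>

definition beta0 :: real where
  "beta0 = (THE x. 0 < x \<and> x < 1/2 \<and> nbr_coeff x = 0)"

definition strongly_depends ::
  "(nat \<Rightarrow> nat \<Rightarrow> real) \<Rightarrow> nat \<Rightarrow> real \<Rightarrow> nat \<Rightarrow> nat \<Rightarrow> bool" where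
  "strongly_depends A m \<theta> i j \<longleftrightarrow>
     i \<in> {1..m} \<and> j \<in> {1..m} \<and> j \<noteq> i \<and> - A i j \<ge> \<theta> * Max ((\<lambda>k. - A i k) ` ({1..m} - {i}))"

definition interp_vars ::
  "(nat \<Rightarrow> nat \<Rightarrow> real) \<Rightarrow> nat \<Rightarrow> real \<Rightarrow> nat set \<Rightarrow> nat \<Rightarrow> nat set" where
  "interp_vars A m \<theta> C i = {k \<in> C. strongly_depends A m \<theta> i k}"

definition CF_splitting :: "nat \<Rightarrow> nat set \<Rightarrow> nat set \<Rightarrow> bool" where
  "CF_splitting m C F \<longleftrightarrow> C \<union> F = {1..m} \<and> C \<inter> F = {}"

text \<open>
  The first Ruge--Stueben coarsening criterion, which an admissible splitting of classical AMG
  satisfies: each \<open>j\<close> on which an F-variable \<open>i\<close> depends strongly is a C-variable or itself depends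
  strongly on an interpolatory variable of \<open>i\<close>. It cannot be dropped: if all variables are
  F-variables then every set of interpolatory variables is empty, and no accuracy estimate that is
  uniform in the mesh size can hold.
\<close>

definition RS_criterion ::
  "(nat \<Rightarrow> nat \<Rightarrow> real) \<Rightarrow> nat \<Rightarrow> real \<Rightarrow> nat set \<Rightarrow> nat set \<Rightarrow> bool" where
  "RS_criterion A m \<theta> C F \<longleftrightarrow>
     (\<forall>i\<in>F. \<forall>j. strongly_depends A m \<theta> i j \<longrightarrow>
        j \<in> C \<or> (\<exists>k\<in>interp_vars A m \<theta> C i. strongly_depends A m \<theta> j k))"

definition interp_FC ::
  "(nat \<Rightarrow> nat \<Rightarrow> real) \<Rightarrow> nat \<Rightarrow> real \<Rightarrow> nat set \<Rightarrow> (nat \<Rightarrow> real) \<Rightarrow> nat \<Rightarrow> real" where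
  "interp_FC A m \<theta> C e i = (\<Sum>k\<in>interp_vars A m \<theta> C i. 1/2 * e k)"

definition norm_0F :: "(nat \<Rightarrow> nat \<Rightarrow> real) \<Rightarrow> nat set \<Rightarrow> (nat \<Rightarrow> real) \<Rightarrow> real" where
  "norm_0F A F v = sqrt (\<Sum>i\<in>F. A i i * v i * v i)"

definition norm_1 :: "(nat \<Rightarrow> nat \<Rightarrow> real) \<Rightarrow> nat \<Rightarrow> (nat \<Rightarrow> real) \<Rightarrow> real" where
  "norm_1 A m v = sqrt (\<Sum>i=1..m. (\<Sum>j=1..m. A i j * v j) * v i)"

lemma nbr_coeff_has_unique_root: "\<exists>!x. 0 < x \<and> x < 1/2 \<and> nbr_coeff x = 0"
proof -
  define g :: "real \<Rightarrow> real" where "g p = 3 powr p - 4 * 2 powr p + 7" for p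
  define g1 :: "real \<Rightarrow> real" where "g1 p = ln 3 * 3 powr p - 4 * (ln 2 * 2 powr p)" for p
  define g2 :: "real \<Rightarrow> real" where
    "g2 p = ln 3 * (ln 3 * 3 powr p) - 4 * (ln 2 * (ln 2 * 2 powr p))" for p
  have nbr: "nbr_coeff x = g (3 - 2 * x)" for x
  proof -
    have "(2::real) powr (5 - 2 * x) = 2 powr (2 + (3 - 2 * x))" by simp
    also have "\<dots> = 4 * 2 powr (3 - 2 * x)" by (subst powr_add) simp
    finally show ?thesis by (simp add: nbr_coeff_def g_def)
  qed
  have d1: "(g has_real_derivative g1 p) (at p)" for p
    unfolding g_def g1_def by (auto intro!: derivative_eq_intros)
  have d2: "(g1 has_real_derivative g2 p) (at p)" for p
    unfolding g1_def g2_def by (auto intro!: derivative_eq_intros)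
  have g2_pos: "g2 p > 0" if "p > 2" for p
  proof -
    have "ln (2 ^ 4 :: real) < ln (3 ^ 3)" by (subst ln_less_cancel_iff) auto
    moreover have "ln (2 ^ 4 :: real) = 4 * ln 2" "ln (3 ^ 3 :: real) = 3 * ln 3"
      by (simp_all only: ln_realpow zero_less_numeral of_nat_numeral)
    ultimately have "4 * ln 2 < 3 * ln (3::real)" by linarith
    hence "(4 * ln 2)\<^sup>2 < (3 * ln (3::real))\<^sup>2"
      by (intro power_strict_mono) auto
    hence ln: "4 * (ln 2)\<^sup>2 < 9/4 * (ln (3::real))\<^sup>2" by (simp add: power2_eq_square)
    have "(3/2::real) powr 2 \<le> (3/2) powr p" using that by (intro powr_mono) auto
    hence "9/4 \<le> (3/2::real) powr p" by (simp add: power2_eq_square)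
    hence pw: "9/4 * 2 powr p \<le> (3::real) powr p"
      by (simp add: powr_divide field_simps)
    have "4 * (ln 2)\<^sup>2 * 2 powr p < 9/4 * (ln (3::real))\<^sup>2 * 2 powr p"
      using ln by (intro mult_strict_right_mono) auto
    also have "\<dots> = (ln 3)\<^sup>2 * (9/4 * 2 powr p)" by simp
    also have "\<dots> \<le> (ln 3)\<^sup>2 * 3 powr p" using pw by (intro mult_left_mono) auto
    finally show ?thesis by (simp add: g2_def power2_eq_square mult_ac)
  qed
  have cont: "continuous_on S g" for S
    by (meson DERIV_isCont d1 continuous_at_imp_continuous_on)
  have g2z: "g 2 = 0" by (simp add: g_def)
  have g3: "g 3 = 2" by (simp add: g_def)
  have gm: "g (5/2) < 0"
  proof -
    have "(3::real) powr (5/2) = 3 powr (2 + 1/2)" by simp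
    also have "\<dots> = 9 * sqrt 3" by (subst powr_add) (simp add: powr_half_sqrt)
    finally have e3: "(3::real) powr (5/2) = 9 * sqrt 3" .
    have "(2::real) powr (5/2) = 2 powr (2 + 1/2)" by simp
    also have "\<dots> = 4 * sqrt 2" by (subst powr_add) (simp add: powr_half_sqrt)
    finally have e2: "(2::real) powr (5/2) = 4 * sqrt 2" .
    have "sqrt 3 < 1.7325" by (rule real_less_lsqrt) (auto simp: power2_eq_square)
    moreover have "1.4142 < sqrt (2::real)" by (rule real_less_rsqrt) (auto simp: power2_eq_square)
    ultimately show ?thesis by (simp add: g_def e2 e3)
  qed
  have "\<exists>p. 5/2 \<le> p \<and> p \<le> 3 \<and> g p = 0"
    using gm g3 by (intro IVT') (auto intro: cont)
  then obtain p where p: "5/2 \<le> p" "p \<le> 3" "g p = 0" by blast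
  have "p \<noteq> 3" using p g3 by auto
  have "nbr_coeff ((3 - p) / 2) = g p" unfolding nbr by (rule arg_cong[of _ _ g]) (simp add: field_simps)
  with p \<open>p \<noteq> 3\<close> have ex: "0 < (3 - p) / 2 \<and> (3 - p) / 2 < 1/2 \<and> nbr_coeff ((3 - p) / 2) = 0"
    by simp
  have no: False if uv: "2 < u" "u < v" "g u = 0" "g v = 0" for u v
  proof -
    obtain x where x: "2 < x" "x < u" "g1 x = 0"
      using MVT2[of 2 u g g1] d1 uv g2z by auto
    obtain y where y: "u < y" "y < v" "g1 y = 0"
      using MVT2[of u v g g1] d1 uv by auto
    have "x < y" using x y by simp
    then obtain z where "x < z" "z < y" "g2 z = 0"
      using MVT2[of x y g1 g2] d2 x y \<open>x < y\<close> by auto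
    thus False using g2_pos[of z] x by simp
  qed
  show ?thesis
  proof (rule ex1I[of _ "(3 - p) / 2"])
    show "0 < (3 - p) / 2 \<and> (3 - p) / 2 < 1/2 \<and> nbr_coeff ((3 - p) / 2) = 0" by (rule ex)
    fix y assume y: "0 < y \<and> y < 1/2 \<and> nbr_coeff y = 0"
    show "y = (3 - p) / 2"
    proof (rule ccontr)
      assume "y \<noteq> (3 - p) / 2"
      hence "3 - 2 * y < p \<or> p < 3 - 2 * y" by (auto simp: field_simps)
      thus False using no[of "3 - 2 * y" p] no[of p "3 - 2 * y"] y p by (auto simp: nbr)
    qed
  qed
qed

end

theory Submission
  imports Defs
begin

text \<open>
  The matrix is the Toeplitz matrix of \<open>S h\<close> times a mass stencil plus \<open>V\<close> times
  \<open>h powr (2 * (\<gamma> - \<beta>)) * u + g\<close>, where \<open>u\<close> and \<open>g\<close> are the scaled stencils of the orders \<open>\<beta>\<close> and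
  \<open>\<gamma>\<close>. Entries, partial sums and increments of the stencils are forward differences of
  \<open>x powr (3 - 2 * \<mu>)\<close> and so have known signs. Together with the condition on \<open>h\<close>, which lets the
  entry \<open>g 1 < 0\<close> absorb a positive \<open>u 1\<close>, diagonal dominance gives the energy bound
  \[ \|e\|_1^2 \ge \frac{S h}{3} |e|^2 + \frac{V |g_1|}{2} \sum_i (e_{i+1} - e_i)^2 , \]
  with \<open>e\<close> extended by zero. There are three regimes. If \<open>h\<close> is bounded below, the discrete Poincare
  inequality bounds \<open>|e|\<close> by the sum of differences. If \<open>h\<close> is small and \<open>S h\<close> is at least a fixed
  multiple of \<open>V\<close>, the mass term alone controls the diagonal, and \<open>(\<ast>)\<close> keeps the number of
  interpolatory variables at most 2. If \<open>h\<close> is small and \<open>S h\<close> is at most that multiple of \<open>V\<close>, the ratio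
  of the second to the first off-diagonal is close to or below \<open>g 2 / g 1 < 1\<close>, so the strong
  connections are exactly the neighbours, the coarsening criterion puts both neighbours of an
  F-variable into \<open>C\<close>, and the interpolation error is a mean of two differences.
\<close>

section \<open>Signs of the fractional stencil\<close>

text \<open>Iterated unit-step forward difference of \<open>x powr p\<close>. The exponent is an
  argument because differentiation lowers it by one and keeps the order of the difference.\<close>

primrec fdiff :: "nat \<Rightarrow> real \<Rightarrow> real \<Rightarrow> real" where
  "fdiff 0 p x = x powr p"
| "fdiff (Suc n) p x = fdiff n p (x + 1) - fdiff n p x"

lemma has_real_derivative_fdiff:
  "x > 0 \<Longrightarrow> (fdiff n p has_real_derivative p * fdiff n (p - 1) x) (at x)"
proof (induction n arbitrary: x)
  case 0
  have "((\<lambda>x. x powr p) has_real_derivative p * x powr (p - 1)) (at x)"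
    using 0 by (rule has_real_derivative_powr)
  thus ?case by (simp add: fun_eq_iff[symmetric] fdiff.simps(1)[abs_def])
next
  case (Suc n)
  have "((\<lambda>x. fdiff n p (x + 1)) has_real_derivative p * fdiff n (p - 1) (x + 1)) (at x)"
    using Suc.IH[of "x + 1"] Suc.prems by (simp add: DERIV_shift)
  from DERIV_diff[OF this Suc.IH[OF Suc.prems]]
  show ?case by (simp add: fdiff.simps(2)[abs_def] right_diff_distrib)
qed

text \<open>By the mean value theorem a difference of order \<open>n + 1\<close> is \<open>p\<close>
  times one of order \<open>n\<close> with exponent \<open>p - 1\<close> at an intermediate point.
  Iteration produces the falling factorial of \<open>p\<close>; multiplying by it once more turns
  every factor into a square, so no signs have to be tracked.\<close>

lemma fdiff_sign_pos: "x > 0 \<Longrightarrow> 0 \<le> (\<Prod>i<n. p - real i) * fdiff n p x"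
proof (induction n arbitrary: p x)
  case 0
  then show ?case by simp
next
  case (Suc n)
  have "\<And>y. x \<le> y \<Longrightarrow> (fdiff n p has_real_derivative p * fdiff n (p - 1) y) (at y)"
    using Suc.prems by (intro has_real_derivative_fdiff) auto
  then obtain z where z: "x < z" "fdiff n p (x + 1) - fdiff n p x = p * fdiff n (p - 1) z"
    using MVT2[of x "x + 1" "fdiff n p" "\<lambda>y. p * fdiff n (p - 1) y"] by auto
  have "(\<Prod>i<Suc n. p - real i) = p * (\<Prod>i<n. (p - 1) - real i)"
    by (subst prod.lessThan_Suc_shift) (simp add: algebra_simps)
  hence "(\<Prod>i<Suc n. p - real i) * fdiff (Suc n) p x
      = p\<^sup>2 * ((\<Prod>i<n. (p - 1) - real i) * fdiff n (p - 1) z)"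
    using z by (simp add: power2_eq_square)
  moreover have "0 \<le> (\<Prod>i<n. (p - 1) - real i) * fdiff n (p - 1) z"
    using z Suc.prems by (intro Suc.IH) simp
  ultimately show ?case by (simp only: zero_le_mult_iff zero_le_power2 simp_thms)
qed

text \<open>For \<open>p > 0\<close> the default value \<open>0 powr p = 0\<close> is also the limit
  from the right, so signs of differences carry over to the endpoint 0.\<close>

lemma continuous_on_fdiff: "p > 0 \<Longrightarrow> continuous_on {0..} (fdiff n p)"
proof (induction n)
  case 0
  have "continuous_on {0..} (\<lambda>x::real. x powr p)"
    using 0 by (intro continuous_on_powr' continuous_intros) auto
  thus ?case by (simp add: fdiff.simps(1)[abs_def])
next
  case (Suc n)
  have "continuous_on {0..} (\<lambda>x. fdiff n p (x + 1))"
    by (rule continuous_on_compose2[OF Suc.IH[OF Suc.prems]]) (auto intro!: continuous_intros)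
  thus ?case using Suc by (simp add: fdiff.simps(2)[abs_def] continuous_on_diff)
qed

text \<open>The point \<open>x = 0\<close>, where \<open>x powr p\<close> need not be smooth, is what the first entries of the stencil require.\<close>

lemma fdiff_sign:
  assumes "x \<ge> 0" "p > 0"
  shows "0 \<le> (\<Prod>i<n. p - real i) * fdiff n p x"
proof (cases "x = 0")
  case False
  then show ?thesis using assms fdiff_sign_pos by simp
next
  case True
  have "(fdiff n p \<longlongrightarrow> fdiff n p 0) (at 0 within {0..})"
    using continuous_on_fdiff[OF assms(2), of n] by (simp add: continuous_on_def)
  hence "(fdiff n p \<longlongrightarrow> fdiff n p 0) (at_right 0)"
    by (rule tendsto_within_subset) auto
  hence "((\<lambda>x. (\<Prod>i<n. p - real i) * fdiff n p x) \<longlongrightarrow> (\<Prod>i<n. p - real i) * fdiff n p 0) (at_right 0)"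
    by (intro tendsto_intros)
  moreover have "eventually (\<lambda>x. 0 \<le> (\<Prod>i<n. p - real i) * fdiff n p x) (at_right 0)"
    using eventually_at_right_less[of "0::real"] by eventually_elim (rule fdiff_sign_pos)
  ultimately show ?thesis
    using True by (auto intro: tendsto_lowerbound)
qed

text \<open>The weights 1, -4, 6, -4, 1 form a fourth difference centred at \<open>l\<close>, that
  is, a forward one started at \<open>l - 2\<close>.\<close>

lemma frac_stencil_fdiff:
  assumes "l \<ge> 2"
  shows "frac_stencil \<mu> l = fdiff 4 (3 - 2 * \<mu>) (real l - 2)"
  using assms by (simp add: frac_stencil_def eval_nat_numeral algebra_simps)

text \<open>Telescoping: entries from \<open>l = 2\<close> on are increments of the third
  difference, and half the diagonal plus the neighbour entry is its value at 0. Only half the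
  diagonal enters because each side of it is summed separately.\<close>

lemma frac_stencil_partial_sum:
  "frac_stencil \<mu> 0 / 2 + (\<Sum>l=1..Suc k. frac_stencil \<mu> l) = fdiff 3 (3 - 2 * \<mu>) (real k)"
proof (induction k)
  case 0
  have "2 powr (4 - 2 * \<mu>) = 2 powr (1 + (3 - 2 * \<mu>))" "2 powr (5 - 2 * \<mu>) = 2 powr (2 + (3 - 2 * \<mu>))"
    by simp_all
  hence e: "2 powr (4 - 2 * \<mu>) = 2 * 2 powr (3 - 2 * \<mu>)" "2 powr (5 - 2 * \<mu>) = 4 * 2 powr (3 - 2 * \<mu>)"
    by (simp_all only: powr_add) simp_all
  show ?case
    by (simp add: frac_stencil_def nbr_coeff_def e eval_nat_numeral) (simp add: field_simps)
next
  case (Suc k)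
  have "fdiff 3 (3 - 2 * \<mu>) (real (Suc k)) = fdiff 3 (3 - 2 * \<mu>) (real k) + fdiff 4 (3 - 2 * \<mu>) (real k)"
    by (simp add: eval_nat_numeral algebra_simps)
  also have "fdiff 4 (3 - 2 * \<mu>) (real k) = frac_stencil \<mu> (Suc (Suc k))"
    by (subst frac_stencil_fdiff) auto
  finally show ?case using Suc by simp
qed

section \<open>Signs of the scaled stencils for both ranges of the order\<close>

definition riesz_const :: "real \<Rightarrow> real" where
  "riesz_const \<mu> = 1 / (2 * cos (\<mu> * pi) * Gamma (4 - 2 * \<mu>))"

lemma riesz_const_pos: "0 < \<mu> \<Longrightarrow> \<mu> < 1/2 \<Longrightarrow> 0 < riesz_const \<mu>"
proof -
  assume "0 < \<mu>" "\<mu> < 1/2"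
  moreover from this have "0 < cos (\<mu> * pi)"
    by (intro cos_gt_zero_pi) (auto intro: less_trans[of _ 0])
  ultimately show ?thesis by (simp add: riesz_const_def)
qed

lemma riesz_const_neg: "1/2 < \<mu> \<Longrightarrow> \<mu> < 1 \<Longrightarrow> riesz_const \<mu> < 0"
proof -
  assume *: "1/2 < \<mu>" "\<mu> < 1"
  have "0 < cos ((1 - \<mu>) * pi)"
  proof (rule cos_gt_zero_pi)
    show "(1 - \<mu>) * pi < pi / 2" using mult_strict_right_mono[of "1 - \<mu>" "1/2" pi] * by simp
    have "0 < (1 - \<mu>) * pi" using * by simp
    thus "- (pi / 2) < (1 - \<mu>) * pi" using pi_gt_zero by linarith
  qed
  also have "cos ((1 - \<mu>) * pi) = - cos (\<mu> * pi)"
    by (simp add: left_diff_distrib cos_diff)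
  finally show ?thesis using * by (simp add: riesz_const_def divide_neg_pos mult_neg_pos zero_less_mult_iff)
qed

text \<open>\<open>1 - 2 * \<mu>\<close> and the cosine in \<open>riesz_const\<close> have the same
  sign, so this factor of the falling factorial can be traded for \<open>riesz_const\<close>. Orders
  below and above 1/2 are thereby treated at once.\<close>

lemma riesz_const_sign:
  assumes \<mu>: "0 < \<mu>" "\<mu> < 1" "\<mu> \<noteq> 1/2" and X: "0 \<le> (1 - 2 * \<mu>) * X"
  shows "0 \<le> riesz_const \<mu> * X"
proof (cases "\<mu> < 1/2")
  case True
  thus ?thesis using riesz_const_pos[of \<mu>] \<mu> X by (simp add: zero_le_mult_iff)
next
  case False
  thus ?thesis using riesz_const_neg[of \<mu>] \<mu> X by (simp add: zero_le_mult_iff)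
qed

text \<open>Among the three factors of the falling factorial of \<open>3 - 2 * \<mu>\<close> only
  \<open>1 - 2 * \<mu>\<close> can be negative.\<close>

lemma riesz_partial_sum_nonneg:
  assumes \<mu>: "0 < \<mu>" "\<mu> < 1" "\<mu> \<noteq> 1/2"
  shows "0 \<le> riesz_const \<mu> * (frac_stencil \<mu> 0 / 2 + (\<Sum>l=1..Suc k. frac_stencil \<mu> l))"
proof (rule riesz_const_sign[OF \<mu>])
  have "0 \<le> (\<Prod>i<3. (3 - 2 * \<mu>) - real i) * fdiff 3 (3 - 2 * \<mu>) (real k)"
    using \<mu> by (intro fdiff_sign) auto
  also have "\<dots> = ((3 - 2 * \<mu>) * (2 - 2 * \<mu>)) * ((1 - 2 * \<mu>) * fdiff 3 (3 - 2 * \<mu>) (real k))"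
    by (simp add: eval_nat_numeral)
  finally have "0 \<le> (1 - 2 * \<mu>) * fdiff 3 (3 - 2 * \<mu>) (real k)"
    by (rule zero_le_mult_iff[THEN iffD1, THEN disjE]) (use \<mu> in \<open>auto simp: mult_le_0_iff\<close>)
  thus "0 \<le> (1 - 2 * \<mu>) * (frac_stencil \<mu> 0 / 2 + (\<Sum>l=1..Suc k. frac_stencil \<mu> l))"
    by (simp only: frac_stencil_partial_sum)
qed

text \<open>The fourth difference brings in the negative factor \<open>- 2 * \<mu>\<close>, which
  reverses the sign found for the third.\<close>

lemma riesz_tail_nonpos:
  assumes \<mu>: "0 < \<mu>" "\<mu> < 1" "\<mu> \<noteq> 1/2" and l: "2 \<le> l"
  shows "riesz_const \<mu> * frac_stencil \<mu> l \<le> 0"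
proof -
  have "0 \<le> (\<Prod>i<4. (3 - 2 * \<mu>) - real i) * fdiff 4 (3 - 2 * \<mu>) (real l - 2)"
    using \<mu> l by (intro fdiff_sign) auto
  also have "\<dots> = ((3 - 2 * \<mu>) * (2 - 2 * \<mu>) * (2 * \<mu>)) * ((1 - 2 * \<mu>) * - frac_stencil \<mu> l)"
    using l by (simp add: frac_stencil_fdiff) (simp add: eval_nat_numeral)
  finally have "0 \<le> (1 - 2 * \<mu>) * - frac_stencil \<mu> l"
    by (rule zero_le_mult_iff[THEN iffD1, THEN disjE]) (use \<mu> in \<open>auto simp: mult_le_0_iff\<close>)
  from riesz_const_sign[OF \<mu> this] show ?thesis by simp
qed

text \<open>Increments of the tail are fifth differences; the negative factors
  \<open>- 2 * \<mu>\<close> and \<open>- 1 - 2 * \<mu>\<close> cancel in sign.\<close>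

lemma riesz_tail_mono:
  assumes \<mu>: "0 < \<mu>" "\<mu> < 1" "\<mu> \<noteq> 1/2" and l: "2 \<le> l"
  shows "riesz_const \<mu> * frac_stencil \<mu> l \<le> riesz_const \<mu> * frac_stencil \<mu> (Suc l)"
proof -
  have p5: "(\<Prod>i<5. f i) = f 0 * f 1 * f 2 * f 3 * f 4" for f :: "nat \<Rightarrow> real"
    by (simp add: eval_nat_numeral mult_ac)
  have e: "fdiff 5 p (real l - 2) = fdiff 4 p (real (Suc l) - 2) - fdiff 4 p (real l - 2)" for p
    by (simp add: eval_nat_numeral algebra_simps)
  have "0 \<le> (\<Prod>i<5. (3 - 2 * \<mu>) - real i) * fdiff 5 (3 - 2 * \<mu>) (real l - 2)"
    using \<mu> l by (intro fdiff_sign) auto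
  also have "fdiff 5 (3 - 2 * \<mu>) (real l - 2) = frac_stencil \<mu> (Suc l) - frac_stencil \<mu> l"
    unfolding e using l by (simp only: frac_stencil_fdiff)
  also have "(\<Prod>i<5. (3 - 2 * \<mu>) - real i)
      = ((3 - 2 * \<mu>) * (2 - 2 * \<mu>) * (2 * \<mu>) * (1 + 2 * \<mu>)) * (1 - 2 * \<mu>)"
    unfolding p5 by (simp only: of_nat_0 of_nat_1 of_nat_numeral) algebra
  finally have "0 \<le> ((3 - 2 * \<mu>) * (2 - 2 * \<mu>) * (2 * \<mu>) * (1 + 2 * \<mu>))
      * ((1 - 2 * \<mu>) * (frac_stencil \<mu> (Suc l) - frac_stencil \<mu> l))"
    by (simp only: mult.assoc)
  hence "0 \<le> (1 - 2 * \<mu>) * (frac_stencil \<mu> (Suc l) - frac_stencil \<mu> l)"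
    by (rule zero_le_mult_iff[THEN iffD1, THEN disjE]) (use \<mu> in \<open>auto simp: mult_le_0_iff\<close>)
  from riesz_const_sign[OF \<mu> this] show ?thesis by (simp add: right_diff_distrib)
qed

section \<open>The nearest-neighbour entry as a function of the order\<close>

lemma nbr_coeff_eq: "nbr_coeff \<mu> = 3 powr (3 - 2 * \<mu>) - 4 * 2 powr (3 - 2 * \<mu>) + 7"
proof -
  have "(2::real) powr (5 - 2 * \<mu>) = 2 powr (2 + (3 - 2 * \<mu>))" by simp
  also have "\<dots> = 4 * 2 powr (3 - 2 * \<mu>)" by (subst powr_add) simp
  finally show ?thesis by (simp add: nbr_coeff_def)
qed

text \<open>Logarithms of 243 < 256 and 8 < 9.\<close>

lemma ln_3_less: "5 * ln 3 < 8 * ln (2::real)"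
  and ln_3_greater: "3 * ln 2 < 2 * ln (3::real)"
proof -
  have "ln (3 ^ 5 :: real) < ln (2 ^ 8)" by (subst ln_less_cancel_iff) auto
  thus "5 * ln 3 < 8 * ln (2::real)"
    by (simp only: ln_realpow zero_less_numeral of_nat_numeral)
  have "ln (2 ^ 3 :: real) < ln (3 ^ 2)" by (subst ln_less_cancel_iff) auto
  thus "3 * ln 2 < 2 * ln (3::real)"
    by (simp only: ln_realpow zero_less_numeral of_nat_numeral)
qed

definition nbr_deriv :: "real \<Rightarrow> real" where
  "nbr_deriv p = ln 3 * 3 powr p - 4 * (ln 2 * 2 powr p)"

lemma has_real_derivative_nbr:
  "((\<lambda>p. 3 powr p - 4 * 2 powr p + 7) has_real_derivative nbr_deriv p) (at p)"
  unfolding nbr_deriv_def by (auto intro!: derivative_eq_intros)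

text \<open>The bracket increases with \<open>p\<close>, so the derivative changes sign at most
  once, from negative to positive.\<close>

lemma nbr_deriv_eq: "nbr_deriv p = 2 powr p * (ln 3 * (3/2) powr p - 4 * ln 2)"
  by (simp add: nbr_deriv_def powr_divide field_simps)

text \<open>As a function of the exponent \<open>3 - 2 * \<mu>\<close>, which is below 2, the
  expression decreases to its zero at 2.\<close>

lemma nbr_coeff_pos:
  assumes "1/2 < \<mu>"
  shows "0 < nbr_coeff \<mu>"
proof -
  have "nbr_deriv q < 0" if "q < 2" for q
  proof -
    have "(3/2) powr q \<le> (3/2::real) powr 2" using that by (intro powr_mono) auto
    hence "ln 3 * (3/2) powr q \<le> ln 3 * (9/4::real)" by (simp add: power2_eq_square)
    moreover have "0 < ln (2::real)" by simp
    ultimately have "ln 3 * (3/2) powr q - 4 * ln 2 < (0::real)" using ln_3_less by linarith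
    thus ?thesis unfolding nbr_deriv_eq by (intro mult_pos_neg) auto
  qed
  moreover obtain z where "3 - 2 * \<mu> < z" "z < 2"
      "((3::real) powr 2 - 4 * 2 powr 2 + 7) - (3 powr (3 - 2 * \<mu>) - 4 * 2 powr (3 - 2 * \<mu>) + 7)
        = (2 - (3 - 2 * \<mu>)) * nbr_deriv z"
    using MVT2[of "3 - 2 * \<mu>" 2 _ nbr_deriv, OF _ has_real_derivative_nbr] assms by auto
  ultimately have "- nbr_coeff \<mu> = (2 * \<mu> - 1) * nbr_deriv z" "nbr_deriv z < 0"
    by (auto simp: nbr_coeff_eq)
  thus ?thesis using assms mult_pos_neg[of "2 * \<mu> - 1" "nbr_deriv z"] by simp
qed

text \<open>The exponents satisfy \<open>2 < 3 - 2 * \<beta> < 3 - 2 * beta0\<close>. A positive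
  value at the middle one forces a positive derivative before it; the derivative then stays
  positive, which contradicts the zero at the last one.\<close>

lemma nbr_coeff_nonpos:
  assumes "beta0 \<le> \<beta>" "\<beta> < 1/2"
  shows "nbr_coeff \<beta> \<le> 0"
proof (rule ccontr)
  assume "\<not> nbr_coeff \<beta> \<le> 0"
  hence pos: "0 < nbr_coeff \<beta>" by simp
  have b0: "nbr_coeff beta0 = 0"
    using theI'[OF nbr_coeff_has_unique_root] unfolding beta0_def by blast
  hence lt: "beta0 < \<beta>" using pos assms by (cases "beta0 = \<beta>") auto
  obtain z where z: "2 < z" "z < 3 - 2 * \<beta>"
      "(3 powr (3 - 2 * \<beta>) - 4 * 2 powr (3 - 2 * \<beta>) + 7) - ((3::real) powr 2 - 4 * 2 powr 2 + 7)
        = ((3 - 2 * \<beta>) - 2) * nbr_deriv z"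
    using MVT2[of 2 "3 - 2 * \<beta>" _ nbr_deriv, OF _ has_real_derivative_nbr] assms by auto
  hence "0 < (1 - 2 * \<beta>) * nbr_deriv z" using pos by (simp add: nbr_coeff_eq)
  hence dz: "0 < nbr_deriv z" using assms by (simp add: zero_less_mult_iff)
  obtain y where y: "3 - 2 * \<beta> < y" "y < 3 - 2 * beta0"
      "(3 powr (3 - 2 * beta0) - 4 * 2 powr (3 - 2 * beta0) + 7) - (3 powr (3 - 2 * \<beta>) - 4 * 2 powr (3 - 2 * \<beta>) + 7)
        = ((3 - 2 * beta0) - (3 - 2 * \<beta>)) * nbr_deriv y"
    using MVT2[of "3 - 2 * \<beta>" "3 - 2 * beta0" _ nbr_deriv, OF _ has_real_derivative_nbr] lt by auto
  have "(3/2::real) powr z \<le> (3/2) powr y" using z y by (intro powr_mono) auto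
  hence "ln 3 * (3/2::real) powr z \<le> ln 3 * (3/2) powr y" by (intro mult_left_mono) auto
  moreover have "0 < ln 3 * (3/2) powr z - 4 * ln (2::real)"
    using dz unfolding nbr_deriv_eq by (simp only: zero_less_mult_iff) simp
  ultimately have "0 < ln 3 * (3/2) powr y - 4 * ln (2::real)" by linarith
  hence "0 < nbr_deriv y" unfolding nbr_deriv_eq by simp
  hence "0 < (2 * \<beta> - 2 * beta0) * nbr_deriv y" using lt by simp
  thus False using y(3) b0 pos by (simp add: nbr_coeff_eq)
qed

lemma frac_stencil_2_less:
  assumes "1/2 < \<mu>" "\<mu> < 1"
  shows "frac_stencil \<mu> 2 < frac_stencil \<mu> 1"
proof -
  \<comment> \<open>\<open>f (3 - 2 * \<mu>)\<close> is the difference of the two entries; \<open>f\<close> vanishes at 2 and increases before it,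
    as \<open>g p = f' p / 2 powr p\<close> is decreasing there and still positive at 2.\<close>
  define f where "f p = (4::real) powr p - 5 * 3 powr p + 10 * 2 powr p - 11" for p
  define g where "g p = 2 * ln 2 * (2::real) powr p - 5 * ln 3 * (3/2) powr p + 10 * ln 2" for p
  define g' where "g' p = 2 * ln 2 * (ln 2 * (2::real) powr p) - 5 * ln 3 * (ln (3/2) * (3/2) powr p)" for p
  have ln4: "ln 4 = 2 * ln (2::real)"
    using ln_realpow[of 2 2] by simp
  have p4: "(4::real) powr p = 2 powr p * 2 powr p" for p
    using powr_mult[of 2 2 p] by simp
  have p3: "(3::real) powr p = 2 powr p * (3/2) powr p" for p
    using powr_mult[of 2 "3/2" p] by simp
  have df: "(f has_real_derivative 2 powr p * g p) (at p)" for p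
  proof -
    have "(f has_real_derivative ln 4 * 4 powr p - 5 * (ln 3 * 3 powr p) + 10 * (ln 2 * 2 powr p)) (at p)"
      unfolding f_def by (auto intro!: derivative_eq_intros)
    thus ?thesis by (simp add: g_def ln4 p4 p3 algebra_simps)
  qed
  have dg: "(g has_real_derivative g' p) (at p)" for p
    unfolding g_def g'_def by (auto intro!: derivative_eq_intros)
  have l2: "0 < ln (2::real)" by simp
  \<comment> \<open>After division by \<open>(3/2) powr p\<close> the worst case is
    \<open>p = 2\<close>, where the claim reduces to 32/9 < 15/4.\<close>
  have g'neg: "g' p < 0" if "p < 2" for p
  proof -
    have "(4/3) powr p \<le> (4/3::real) powr 2" using that by (intro powr_mono) auto
    hence "(4/3) powr p \<le> (16/9::real)" by (simp add: power2_eq_square)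
    hence "2 * (ln 2 * ln 2) * (4/3) powr p \<le> 2 * (ln 2 * ln 2) * (16/9::real)"
      by (intro mult_left_mono) auto
    also have "\<dots> < 5 * (3/2 * ln 2) * (1/2 * ln 2)" using l2 by simp
    also have "\<dots> \<le> 5 * ln 3 * ln (3/2)"
      using ln_3_greater l2 by (intro mult_mono) (auto simp: ln_div)
    finally have "(3/2) powr p * (2 * (ln 2 * ln 2) * (4/3) powr p) < (3/2) powr p * (5 * ln 3 * ln (3/2))"
      by (intro mult_strict_left_mono) auto
    moreover have "(2::real) powr p = (3/2) powr p * (4/3) powr p"
      using powr_mult[of "3/2" "4/3" p] by simp
    ultimately show ?thesis by (simp add: g'_def mult_ac)
  qed
  \<comment> \<open>This is \<open>45/4 * ln 3 < 18 * ln 2\<close>, a multiple of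
    \<open>ln_3_less\<close>.\<close>
  have g2: "0 < g 2"
    using ln_3_less by (simp add: g_def power2_eq_square)
  have gpos: "0 < g p" if p: "p < 2" for p
  proof -
    obtain z where "z < 2" "g 2 - g p = (2 - p) * g' z"
      using MVT2[of p 2 g g'] dg p by auto
    moreover from this have "(2 - p) * g' z < 0" using g'neg p by (intro mult_pos_neg) auto
    ultimately show ?thesis using g2 by linarith
  qed
  define p where "p = 3 - 2 * \<mu>"
  have "p < 2" using assms by (simp add: p_def)
  then obtain z where "z < 2" "f 2 - f p = (2 - p) * (2 powr z * g z)"
    using MVT2[of p 2 f "\<lambda>p. 2 powr p * g p"] df by auto
  moreover from this have "0 < (2 - p) * (2 powr z * g z)" using gpos \<open>p < 2\<close> by simp
  moreover have "f 2 = 0" by (simp add: f_def)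
  ultimately have "f p < 0" by linarith
  thus ?thesis using assms
    by (simp add: f_def p_def frac_stencil_def nbr_coeff_eq)
qed

section \<open>Toeplitz quadratic forms\<close>

definition toeplitz :: "(nat \<Rightarrow> real) \<Rightarrow> nat \<Rightarrow> nat \<Rightarrow> real" where
  "toeplitz c i j = c (nat \<bar>int i - int j\<bar>)"

definition quad :: "(nat \<Rightarrow> nat \<Rightarrow> real) \<Rightarrow> nat \<Rightarrow> (nat \<Rightarrow> real) \<Rightarrow> real" where
  "quad A m v = (\<Sum>i=1..m. (\<Sum>j=1..m. A i j * v j) * v i)"

definition zero_ext :: "nat \<Rightarrow> (nat \<Rightarrow> real) \<Rightarrow> nat \<Rightarrow> real" where
  "zero_ext m v i = (if i \<in> {1..m} then v i else 0)"

text \<open>The index starts at 0 and ends at \<open>m\<close>, so the jumps to the zero boundary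
  values at 0 and \<open>m + 1\<close> are counted.\<close>

definition dirichlet :: "nat \<Rightarrow> (nat \<Rightarrow> real) \<Rightarrow> real" where
  "dirichlet m v = (\<Sum>i\<le>m. (zero_ext m v (Suc i) - zero_ext m v i)\<^sup>2)"

lemma dirichlet_nonneg: "0 \<le> dirichlet m v"
  unfolding dirichlet_def by (intro sum_nonneg) auto

lemma quad_add: "quad (\<lambda>i j. A i j + B i j) m v = quad A m v + quad B m v"
  by (simp add: quad_def algebra_simps sum.distrib)

lemma quad_cmult: "quad (\<lambda>i j. k * A i j) m v = k * quad A m v"
  by (simp add: quad_def sum_distrib_left sum_distrib_right mult_ac)

text \<open>Each mixed term is bounded by the arithmetic-geometric mean inequality; by symmetry its
  two halves can be charged to the same row, where the diagonal pays for them.\<close>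

lemma quad_diag_dominant_nonneg:
  assumes sym: "\<And>i j. A i j = A j i"
    and dom: "\<And>i. i \<in> {1..m} \<Longrightarrow> (\<Sum>j\<in>{1..m}-{i}. \<bar>A i j\<bar>) \<le> A i i"
  shows "0 \<le> quad A m v"
proof -
  define w where "w i j = (if i = j then 0 else \<bar>A i j\<bar>)" for i j
  have w_sym: "w i j = w j i" for i j
    by (simp add: w_def sym)
  have wsum: "(\<Sum>j=1..m. w i j) = (\<Sum>j\<in>{1..m}-{i}. \<bar>A i j\<bar>)" for i
    by (rule sum.mono_neutral_cong_right) (auto simp: w_def)
  have swap: "(\<Sum>i=1..m. \<Sum>j=1..m. w i j * (v j)\<^sup>2) = (\<Sum>i=1..m. \<Sum>j=1..m. w i j * (v i)\<^sup>2)"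
    using sum.swap[of "\<lambda>i j. w i j * (v j)\<^sup>2" "{1..m}" "{1..m}"] by (simp add: w_sym)
  have pt: "(if i = j then A i i * (v i)\<^sup>2 else 0) - w i j * ((v i)\<^sup>2 + (v j)\<^sup>2) / 2 \<le> A i j * v j * v i" for i j
  proof (cases "i = j")
    case True
    then show ?thesis by (simp add: w_def power2_eq_square)
  next
    case False
    have "2 * \<bar>v j * v i\<bar> \<le> (v i)\<^sup>2 + (v j)\<^sup>2"
      using sum_squares_bound[of "\<bar>v i\<bar>" "\<bar>v j\<bar>"] by (simp add: abs_mult mult_ac)
    hence "\<bar>A i j\<bar> * (2 * \<bar>v j * v i\<bar>) \<le> \<bar>A i j\<bar> * ((v i)\<^sup>2 + (v j)\<^sup>2)"
      by (rule mult_left_mono) simp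
    moreover have "- (\<bar>A i j\<bar> * \<bar>v j * v i\<bar>) \<le> A i j * v j * v i"
      using abs_ge_minus_self[of "A i j * v j * v i"] by (simp add: abs_mult)
    ultimately show ?thesis using False by (simp add: w_def)
  qed
  have inner: "(if i \<in> {1..m} then A i i * (v i)\<^sup>2 else 0)
        - ((\<Sum>j=1..m. w i j * (v i)\<^sup>2) + (\<Sum>j=1..m. w i j * (v j)\<^sup>2)) / 2
      = (\<Sum>j=1..m. (if i = j then A i i * (v i)\<^sup>2 else 0) - w i j * ((v i)\<^sup>2 + (v j)\<^sup>2) / 2)" for i
  proof -
    have "(\<Sum>j=1..m. w i j * ((v i)\<^sup>2 + (v j)\<^sup>2) / 2)
        = ((\<Sum>j=1..m. w i j * (v i)\<^sup>2) + (\<Sum>j=1..m. w i j * (v j)\<^sup>2)) / 2"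
      unfolding sum.distrib[symmetric] sum_divide_distrib distrib_left by (rule refl)
    thus ?thesis unfolding sum_subtractf by simp
  qed
  have "0 \<le> (\<Sum>i=1..m. (A i i - (\<Sum>j=1..m. w i j)) * (v i)\<^sup>2)"
    using dom by (intro sum_nonneg mult_nonneg_nonneg) (auto simp: wsum simp del: One_nat_def)
  also have "\<dots> = (\<Sum>i=1..m. A i i * (v i)\<^sup>2) - (\<Sum>i=1..m. \<Sum>j=1..m. w i j * (v i)\<^sup>2)"
    unfolding left_diff_distrib sum_subtractf sum_distrib_right by (rule refl)
  also have "\<dots> = (\<Sum>i=1..m. A i i * (v i)\<^sup>2)
       - ((\<Sum>i=1..m. \<Sum>j=1..m. w i j * (v i)\<^sup>2) + (\<Sum>i=1..m. \<Sum>j=1..m. w i j * (v j)\<^sup>2)) / 2"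
    unfolding swap by simp
  also have "\<dots> = (\<Sum>i=1..m. \<Sum>j=1..m. (if i = j then A i i * (v i)\<^sup>2 else 0) - w i j * ((v i)\<^sup>2 + (v j)\<^sup>2) / 2)"
    by (unfold inner[symmetric]) (simp add: sum_subtractf sum_divide_distrib[symmetric] sum.distrib)
  also have "\<dots> \<le> (\<Sum>i=1..m. \<Sum>j=1..m. A i j * v j * v i)"
    by (intro sum_mono pt)
  finally show ?thesis by (simp add: quad_def sum_distrib_right)
qed

lemma sum_offdiag_toeplitz:
  assumes "i \<in> {1..m}"
  shows "(\<Sum>j\<in>{1..m}-{i}. f (nat \<bar>int i - int j\<bar>)) = (\<Sum>l=1..i-1. f l) + (\<Sum>l=1..m-i. (f l::real))"
proof -
  have split: "{1..m} - {i} = {1..<i} \<union> {i<..m}" using assms by auto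
  have "(\<Sum>j\<in>{1..m}-{i}. f (nat \<bar>int i - int j\<bar>)) =
     (\<Sum>j\<in>{1..<i}. f (nat \<bar>int i - int j\<bar>)) + (\<Sum>j\<in>{i<..m}. f (nat \<bar>int i - int j\<bar>))"
    unfolding split by (rule sum.union_disjoint) auto
  moreover have "(\<Sum>j\<in>{1..<i}. f (nat \<bar>int i - int j\<bar>)) = (\<Sum>l=1..i-1. f l)"
    by (rule sum.reindex_bij_witness[of _ "\<lambda>l. i - l" "\<lambda>j. i - j"])
      (use assms in \<open>auto simp: of_nat_diff intro!: arg_cong[of _ _ f]\<close>)
  moreover have "(\<Sum>j\<in>{i<..m}. f (nat \<bar>int i - int j\<bar>)) = (\<Sum>l=1..m-i. f l)"
    by (rule sum.reindex_bij_witness[of _ "\<lambda>l. i + l" "\<lambda>j. j - i"])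
      (use assms in \<open>auto simp: of_nat_diff intro!: arg_cong[of _ _ f]\<close>)
  ultimately show ?thesis by simp
qed

text \<open>Half the diagonal pays for each side of a row, whatever the position of the row.\<close>

lemma quad_toeplitz_nonneg:
  assumes "\<And>k. (\<Sum>l=1..k. \<bar>c l\<bar>) \<le> c 0 / 2"
  shows "0 \<le> quad (toeplitz c) m v"
proof (rule quad_diag_dominant_nonneg)
  show "toeplitz c i j = toeplitz c j i" for i j
    by (simp add: toeplitz_def abs_minus_commute)
  fix i assume i: "i \<in> {1..m}"
  show "(\<Sum>j\<in>{1..m}-{i}. \<bar>toeplitz c i j\<bar>) \<le> toeplitz c i i"
    using sum_offdiag_toeplitz[OF i, of "\<lambda>l. \<bar>c l\<bar>"] assms[of "i - 1"] assms[of "m - i"]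
    by (simp add: toeplitz_def)
qed

text \<open>Summation by parts. The boundary terms make the induction go through; they vanish for a
  zero extension.\<close>

lemma sum_second_difference:
  fixes u :: "nat \<Rightarrow> real"
  shows "(\<Sum>i=1..m. (2 * u i - u (i - 1) - u (Suc i)) * u i) =
    (\<Sum>i\<le>m. (u (Suc i) - u i)\<^sup>2) - u (Suc m) * (u (Suc m) - u m) + u 0 * (u 1 - u 0)"
  by (induction m) (simp_all add: power2_eq_square algebra_simps)

lemma quad_second_difference:
  "quad (toeplitz (\<lambda>l. if l = 0 then 2 else if l = 1 then -1 else 0)) m v = dirichlet m v"
proof -
  define x where "x = zero_ext m v"
  have "(\<Sum>j=1..m. toeplitz (\<lambda>l. if l = 0 then 2 else if l = 1 then -1 else 0) i j * v j)
      = 2 * x i - x (i - 1) - x (Suc i)" if "i \<in> {1..m}" for i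
  proof -
    have "(\<Sum>j=1..m. toeplitz (\<lambda>l. if l = 0 then 2 else if l = 1 then -1 else 0) i j * v j)
      = (\<Sum>j\<in>{i-1,i,Suc i}. toeplitz (\<lambda>l. if l = 0 then 2 else if l = 1 then -1 else 0) i j * x j)"
    proof (rule sum.mono_neutral_cong)
      fix j assume "j \<in> {1..m} - {i - 1, i, Suc i}"
      hence "nat \<bar>int i - int j\<bar> \<noteq> 0" "nat \<bar>int i - int j\<bar> \<noteq> 1" by auto
      thus "toeplitz (\<lambda>l. if l = 0 then 2 else if l = 1 then -1 else 0) i j * v j = 0"
        by (simp add: toeplitz_def)
    qed (auto simp: x_def zero_ext_def)
    moreover have "nat \<bar>int i - int (i - 1)\<bar> = 1" "nat \<bar>int i - int (Suc i)\<bar> = 1" "i - 1 \<noteq> i" "i - 1 \<noteq> Suc i"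
      using that by auto
    ultimately show ?thesis by (simp add: toeplitz_def)
  qed
  hence "quad (toeplitz (\<lambda>l. if l = 0 then 2 else if l = 1 then -1 else 0)) m v
      = (\<Sum>i=1..m. (2 * x i - x (i - 1) - x (Suc i)) * x i)"
    unfolding quad_def by (intro sum.cong) (auto simp: x_def zero_ext_def)
  also have "\<dots> = dirichlet m v"
    unfolding sum_second_difference by (simp add: x_def dirichlet_def zero_ext_def)
  finally show ?thesis .
qed

lemma quad_identity: "quad (toeplitz (\<lambda>l. if l = 0 then 1 else 0)) m v = (\<Sum>i=1..m. (v i)\<^sup>2)"
proof -
  have "(\<Sum>j=1..m. toeplitz (\<lambda>l. if l = 0 then 1 else 0) i j * v j) = v i" if "i \<in> {1..m}" for i
  proof -
    have "toeplitz (\<lambda>l. if l = 0 then 1 else 0) i j * v j = (if j = i then v i else 0)" for j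
      by (auto simp: toeplitz_def)
    thus ?thesis using that by simp
  qed
  thus ?thesis unfolding quad_def by (simp add: power2_eq_square)
qed

section \<open>Inequalities for the size of a vector and for its interpolation error\<close>

text \<open>Telescoping from the zero boundary value and the Cauchy-Schwarz inequality bound every
  single component.\<close>

lemma discrete_poincare: "(\<Sum>i=1..m. (v i)\<^sup>2) \<le> (real m)\<^sup>2 * dirichlet m v"
proof -
  define x where "x = zero_ext m v"
  have "(v i)\<^sup>2 \<le> real m * dirichlet m v" if i: "i \<in> {1..m}" for i
  proof -
    have "v i = (\<Sum>k<i. x (Suc k) - x k)"
      using i by (simp add: sum_lessThan_telescope) (simp add: x_def zero_ext_def)
    also have "\<dots>\<^sup>2 \<le> (\<Sum>k<i. (x (Suc k) - x k)\<^sup>2) * real i"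
      using Cauchy_Schwarz_ineq_sum[of "\<lambda>k. x (Suc k) - x k" "\<lambda>k. 1" "{..<i}"] by simp
    also have "\<dots> \<le> dirichlet m v * real m"
      unfolding dirichlet_def x_def[symmetric] using i
      by (intro mult_mono sum_mono2 sum_nonneg) auto
    finally show ?thesis by (simp add: mult.commute)
  qed
  hence "(\<Sum>i=1..m. (v i)\<^sup>2) \<le> (\<Sum>i=1..m. real m * dirichlet m v)" by (rule sum_mono)
  thus ?thesis by (simp add: power2_eq_square)
qed

text \<open>The deviation from the neighbour average is the mean of two differences; by convexity
  each squared difference is charged at most twice with weight 1/2.\<close>

lemma sum_diff_sq_le_dirichlet:
  "(\<Sum>i=1..m. (v i - (zero_ext m v (i - 1) + zero_ext m v (Suc i)) / 2)\<^sup>2) \<le> dirichlet m v"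
proof -
  define x where "x = zero_ext m v"
  have pt: "(a - (b + c) / 2)\<^sup>2 \<le> ((a - b)\<^sup>2 + (c - a)\<^sup>2) / 2" for a b c :: real
  proof -
    have "((a - b)\<^sup>2 + (c - a)\<^sup>2) / 2 - (a - (b + c) / 2)\<^sup>2 = ((b - c) / 2)\<^sup>2"
      by (simp add: power2_eq_square field_simps)
    thus ?thesis using zero_le_power2[of "(b - c) / 2"] by linarith
  qed
  have "(\<Sum>i=1..m. (v i - (x (i - 1) + x (Suc i)) / 2)\<^sup>2)
      \<le> (\<Sum>i=1..m. ((x i - x (i - 1))\<^sup>2 + (x (Suc i) - x i)\<^sup>2) / 2)"
  proof (rule sum_mono)
    fix i assume "i \<in> {1..m}"
    hence "v i = x i" by (simp add: x_def zero_ext_def)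
    thus "(v i - (x (i - 1) + x (Suc i)) / 2)\<^sup>2 \<le> ((x i - x (i - 1))\<^sup>2 + (x (Suc i) - x i)\<^sup>2) / 2"
      using pt by simp
  qed
  also have "\<dots> = ((\<Sum>i=1..m. (x i - x (i - 1))\<^sup>2) + (\<Sum>i=1..m. (x (Suc i) - x i)\<^sup>2)) / 2"
    by (simp add: sum.distrib sum_divide_distrib[symmetric])
  also have "(\<Sum>i=1..m. (x i - x (i - 1))\<^sup>2) = (\<Sum>i<m. (x (Suc i) - x i)\<^sup>2)"
    by (rule sum.reindex_bij_witness[of _ Suc "\<lambda>i. i - 1"]) auto
  also have "\<dots> \<le> dirichlet m v"
    unfolding dirichlet_def x_def by (intro sum_mono2) auto
  also have "(\<Sum>i=1..m. (x (Suc i) - x i)\<^sup>2) \<le> dirichlet m v"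
    unfolding dirichlet_def x_def by (intro sum_mono2) auto
  finally show ?thesis by (simp add: x_def)
qed

text \<open>\<open>Q\<close> is a symmetric relation containing all interpolation links. After the
  sums are swapped, each \<open>v k\<close> is charged by at most \<open>N\<close> indices; with
  Cauchy-Schwarz over at most \<open>N\<close> summands this gives the factor \<open>N\<close>
  squared.\<close>

lemma sum_half_interp_sq_le:
  fixes v :: "nat \<Rightarrow> real" and P :: "nat \<Rightarrow> nat set"
  assumes sub: "\<And>i. P i \<subseteq> {k \<in> {1..m}. Q i k}" and F: "F \<subseteq> {1..m}"
    and sym: "\<And>i k. Q i k = Q k i" and card: "\<And>i. card {k \<in> {1..m}. Q i k} \<le> N"
  shows "(\<Sum>i\<in>F. (v i - (\<Sum>k\<in>P i. 1/2 * v k))\<^sup>2) \<le> (2 + (real N)\<^sup>2 / 2) * (\<Sum>i=1..m. (v i)\<^sup>2)"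
proof -
  have pt: "(v i - (\<Sum>k\<in>P i. 1/2 * v k))\<^sup>2
      \<le> 2 * (v i)\<^sup>2 + real N / 2 * (\<Sum>k\<in>{k \<in> {1..m}. Q i k}. (v k)\<^sup>2)" for i
  proof -
    define t where "t = (\<Sum>k\<in>P i. v k)"
    have finQ: "finite {k \<in> {1..m}. Q i k}" by (rule finite_subset[of _ "{1..m}"]) auto
    have "card (P i) \<le> N" using card_mono[OF finQ sub[of i]] card[of i] by (rule le_trans)
    have "t\<^sup>2 \<le> (\<Sum>k\<in>P i. (v k)\<^sup>2) * real (card (P i))"
      unfolding t_def using Cauchy_Schwarz_ineq_sum[of v "\<lambda>k. 1" "P i"] by simp
    also have "\<dots> \<le> (\<Sum>k\<in>{k \<in> {1..m}. Q i k}. (v k)\<^sup>2) * real N"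
      using sub[of i] finQ \<open>card (P i) \<le> N\<close> by (intro mult_mono sum_mono2 sum_nonneg) auto
    finally have t: "t\<^sup>2 \<le> (\<Sum>k\<in>{k \<in> {1..m}. Q i k}. (v k)\<^sup>2) * real N" .
    have "(v i - t / 2)\<^sup>2 + (v i + t / 2)\<^sup>2 = 2 * (v i)\<^sup>2 + t\<^sup>2 / 2"
      by (simp add: power2_eq_square field_simps)
    hence "(v i - t / 2)\<^sup>2 \<le> 2 * (v i)\<^sup>2 + t\<^sup>2 / 2"
      using zero_le_power2[of "v i + t / 2"] by linarith
    moreover have half: "(\<Sum>k\<in>P i. 1/2 * v k) = t / 2"
      by (simp add: t_def sum_divide_distrib)
    ultimately show ?thesis unfolding half using t by (simp only: mult.commute)
  qed
  have "(\<Sum>i=1..m. \<Sum>k\<in>{k \<in> {1..m}. Q i k}. (v k)\<^sup>2) = (\<Sum>k=1..m. \<Sum>i\<in>{i \<in> {1..m}. Q i k}. (v k)\<^sup>2)"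
    by (rule sum.swap_restrict) auto
  also have "\<dots> \<le> (\<Sum>k=1..m. real N * (v k)\<^sup>2)"
    using card sym by (intro sum_mono) (auto intro!: mult_right_mono)
  finally have sw: "(\<Sum>i=1..m. \<Sum>k\<in>{k \<in> {1..m}. Q i k}. (v k)\<^sup>2) \<le> real N * (\<Sum>k=1..m. (v k)\<^sup>2)"
    by (simp add: sum_distrib_left)
  have "(\<Sum>i\<in>F. (v i - (\<Sum>k\<in>P i. 1/2 * v k))\<^sup>2) \<le> (\<Sum>i=1..m. (v i - (\<Sum>k\<in>P i. 1/2 * v k))\<^sup>2)"
    using F by (intro sum_mono2) auto
  also have "\<dots> \<le> (\<Sum>i=1..m. 2 * (v i)\<^sup>2 + real N / 2 * (\<Sum>k\<in>{k \<in> {1..m}. Q i k}. (v k)\<^sup>2))"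
    by (intro sum_mono pt)
  also have "\<dots> = 2 * (\<Sum>i=1..m. (v i)\<^sup>2) + real N / 2 * (\<Sum>i=1..m. \<Sum>k\<in>{k \<in> {1..m}. Q i k}. (v k)\<^sup>2)"
    by (simp add: sum.distrib sum_distrib_left)
  also have "\<dots> \<le> 2 * (\<Sum>i=1..m. (v i)\<^sup>2) + real N / 2 * (real N * (\<Sum>k=1..m. (v k)\<^sup>2))"
    by (intro add_left_mono mult_left_mono sw) auto
  finally show ?thesis by (simp add: power2_eq_square algebra_simps)
qed

text \<open>Half of the mass diagonal and a second-difference matrix carrying the entry
  \<open>w 1\<close> are split off. What remains is diagonally dominant, irrespective of the sign of
  \<open>w 1\<close>.\<close>

lemma quad_toeplitz_lower_bound:
  assumes nonneg: "0 \<le> s" "0 \<le> V"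
    and tail: "\<And>l. 2 \<le> l \<Longrightarrow> w l \<le> 0"
    and partial: "\<And>k. 0 \<le> w 0 / 2 + (\<Sum>l=1..Suc k. w l)"
    and c: "\<And>l. c l = s * (if l = 0 then 2/3 else if l = 1 then 1/6 else 0) + V * w l"
  shows "s / 3 * (\<Sum>i=1..m. (v i)\<^sup>2) + V * (- w 1) * dirichlet m v \<le> quad (toeplitz c) m v"
proof -
  define d where "d l = (if l = 0 then s / 3 + V * (w 0 + 2 * w 1) else if l = 1 then s / 6 else V * w l)" for l
  have "toeplitz c = (\<lambda>i j. (s / 3 * toeplitz (\<lambda>l. if l = 0 then 1 else 0) i j
      + V * (- w 1) * toeplitz (\<lambda>l. if l = 0 then 2 else if l = 1 then -1 else 0) i j) + toeplitz d i j)"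
    by (intro ext) (simp add: toeplitz_def c d_def algebra_simps)
  hence "quad (toeplitz c) m v
      = s / 3 * (\<Sum>i=1..m. (v i)\<^sup>2) + V * (- w 1) * dirichlet m v + quad (toeplitz d) m v"
    by (simp only: quad_add quad_cmult quad_identity quad_second_difference)
  moreover have "0 \<le> quad (toeplitz d) m v"
  proof (rule quad_toeplitz_nonneg)
    fix k
    \<comment> \<open>All tail entries are nonpositive, so the absolute values only flip signs; the
      \<open>w 1\<close> inside the sum cancels the separate one.\<close>
    have sum: "(\<Sum>l=1..Suc k. \<bar>d l\<bar>) = s / 6 + V * w 1 - V * (\<Sum>l=1..Suc k. w l)" for k
    proof (induction k)
      case 0
      then show ?case using nonneg by (simp add: d_def)
    next
      case (Suc k)
      have "V * w (Suc (Suc k)) \<le> 0" using nonneg tail by (intro mult_nonneg_nonpos) auto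
      hence "\<bar>d (Suc (Suc k))\<bar> = - (V * w (Suc (Suc k)))" by (simp add: d_def)
      thus ?case using Suc by (simp add: algebra_simps)
    qed
    have pV: "0 \<le> V * (w 0 / 2 + (\<Sum>l=1..Suc k. w l))" for k
      using partial nonneg by (intro mult_nonneg_nonneg) auto
    show "(\<Sum>l=1..k. \<bar>d l\<bar>) \<le> d 0 / 2"
    proof (cases k)
      case 0
      then show ?thesis using pV[of 0] nonneg by (simp add: d_def algebra_simps)
    next
      case (Suc k')
      show ?thesis unfolding Suc sum using pV[of k'] by (simp add: d_def algebra_simps)
    qed
  qed
  ultimately show ?thesis by simp
qed

section \<open>Strong connections and interpolation\<close>

text \<open>The index \<open>j\<close> guarantees a second position, so \<open>i\<close> has a
  neighbour in range: on the right, or on the left when \<open>i\<close> is last.\<close>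

lemma neighbour_le_Max:
  assumes "i \<in> {1..m}" "j \<in> {1..m}" "j \<noteq> i"
  shows "- c (Suc 0) \<le> Max ((\<lambda>k. - toeplitz c i k) ` ({1..m} - {i}))"
proof (cases "i < m")
  case True
  have "- toeplitz c i (Suc i) \<le> Max ((\<lambda>k. - toeplitz c i k) ` ({1..m} - {i}))"
    using True by (intro Max_ge) auto
  thus ?thesis by (simp add: toeplitz_def)
next
  case False
  hence "- toeplitz c i (i - 1) \<le> Max ((\<lambda>k. - toeplitz c i k) ` ({1..m} - {i}))"
    using assms by (intro Max_ge) auto
  thus ?thesis using assms by (simp add: toeplitz_def of_nat_diff)
qed

context
  fixes c :: "nat \<Rightarrow> real" and \<theta> \<epsilon> :: real and m :: nat
  assumes c1: "c 1 < 0" and c2: "c 2 \<le> 0" and tail: "\<And>l. 2 \<le> l \<Longrightarrow> c 2 \<le> c l"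
    and \<theta>: "\<theta> = c 2 / c 1 + \<epsilon>" and \<epsilon>: "0 < \<epsilon>"
begin

text \<open>The maximum is at least \<open>- c 1\<close>, so the threshold is at least
  \<open>- c 2 - \<epsilon> * c 1\<close>. This exceeds \<open>- c 2\<close>, the largest value at
  distance two or more.\<close>

lemma strongly_depends_toeplitz_imp_neighbour:
  assumes "strongly_depends (toeplitz c) m \<theta> i j"
  shows "\<bar>int i - int j\<bar> = 1"
proof (rule ccontr)
  assume neq: "\<bar>int i - int j\<bar> \<noteq> 1"
  define l where "l = nat \<bar>int i - int j\<bar>"
  have ij: "i \<in> {1..m}" "j \<in> {1..m}" "j \<noteq> i"
    and le: "\<theta> * Max ((\<lambda>k. - toeplitz c i k) ` ({1..m} - {i})) \<le> - c l"
    using assms by (auto simp: strongly_depends_def toeplitz_def l_def)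
  have "0 \<le> c 2 / c 1" using c1 c2 by (simp add: divide_nonpos_neg)
  hence "\<theta> * - c 1 \<le> \<theta> * Max ((\<lambda>k. - toeplitz c i k) ` ({1..m} - {i}))"
    using neighbour_le_Max[OF ij, of c] \<theta> \<epsilon> by (intro mult_left_mono) auto
  also have "\<dots> \<le> - c l" by (rule le)
  also have "2 \<le> l" using neq ij by (auto simp: l_def)
  hence "- c l \<le> - c 2" using tail by simp
  finally have "\<theta> * - c 1 \<le> - c 2" .
  moreover have "\<theta> * - c 1 = - c 2 - \<epsilon> * c 1" using c1 by (simp add: \<theta> field_simps)
  moreover have "\<epsilon> * c 1 < 0" using \<epsilon> c1 by (simp add: mult_pos_neg)
  ultimately show False by linarith
qed

text \<open>With \<open>\<theta> \<le> 1\<close> also \<open>c 2 / c 1 < 1\<close>, so the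
  neighbours attain the maximum and pass the test.\<close>

lemma strongly_depends_toeplitz_iff:
  assumes "\<theta> \<le> 1"
  shows "strongly_depends (toeplitz c) m \<theta> i j \<longleftrightarrow> i \<in> {1..m} \<and> j \<in> {1..m} \<and> \<bar>int i - int j\<bar> = 1"
proof
  assume "strongly_depends (toeplitz c) m \<theta> i j"
  thus "i \<in> {1..m} \<and> j \<in> {1..m} \<and> \<bar>int i - int j\<bar> = 1"
    using strongly_depends_toeplitz_imp_neighbour by (auto simp: strongly_depends_def)
next
  assume ij: "i \<in> {1..m} \<and> j \<in> {1..m} \<and> \<bar>int i - int j\<bar> = 1"
  have "c 2 / c 1 < 1" using assms \<theta> \<epsilon> by linarith
  hence c12: "c 1 \<le> c 2" using c1 by (simp add: field_simps)
  have "c 1 \<le> c l" if "l \<noteq> 0" for l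
  proof (cases "l = 1")
    case False
    with that show ?thesis using tail[of l] c12 by linarith
  qed simp
  hence "\<forall>k\<in>{1..m} - {i}. - toeplitz c i k \<le> - c 1" by (auto simp: toeplitz_def)
  moreover have "{1..m} - {i} \<noteq> {}" using ij by auto
  ultimately have M: "Max ((\<lambda>k. - toeplitz c i k) ` ({1..m} - {i})) \<le> - c 1"
    by (subst Max_le_iff) auto
  have t: "0 \<le> \<theta>" using \<theta> \<epsilon> c1 c2 by (simp add: divide_nonpos_neg add_nonneg_nonneg)
  have "\<theta> * Max ((\<lambda>k. - toeplitz c i k) ` ({1..m} - {i})) \<le> \<theta> * - c 1"
    using M t by (rule mult_left_mono)
  also have "\<dots> \<le> 1 * - c 1" using assms c1 by (intro mult_right_mono) auto
  finally show "strongly_depends (toeplitz c) m \<theta> i j"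
    using ij by (auto simp: strongly_depends_def toeplitz_def)
qed

lemma interp_FC_toeplitz_eq_average:
  assumes "\<theta> \<le> 1" "CF_splitting m C F" "RS_criterion (toeplitz c) m \<theta> C F" "i \<in> F"
  shows "interp_FC (toeplitz c) m \<theta> C v i = (zero_ext m v (i - 1) + zero_ext m v (Suc i)) / 2"
proof -
  have i: "i \<in> {1..m}" using assms by (auto simp: CF_splitting_def)
  have "interp_vars (toeplitz c) m \<theta> C i = {i - 1, Suc i} \<inter> {1..m}"
  proof (intro equalityI subsetI)
    fix k assume "k \<in> interp_vars (toeplitz c) m \<theta> C i"
    thus "k \<in> {i - 1, Suc i} \<inter> {1..m}"
      by (auto simp: interp_vars_def strongly_depends_toeplitz_iff[OF assms(1)])
  next
    fix k assume k: "k \<in> {i - 1, Suc i} \<inter> {1..m}"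
    have sd: "strongly_depends (toeplitz c) m \<theta> i k"
      using k i by (auto simp: strongly_depends_toeplitz_iff[OF assms(1)])
    \<comment> \<open>Two neighbours of \<open>i\<close> are never neighbours of each other, so the coarsening criterion leaves
      only \<open>k \<in> C\<close>.\<close>
    have "\<not> strongly_depends (toeplitz c) m \<theta> k k'" if "k' \<in> interp_vars (toeplitz c) m \<theta> C i" for k'
      using that sd by (auto simp: interp_vars_def strongly_depends_toeplitz_iff[OF assms(1)])
    hence "k \<in> C" using assms(3,4) sd unfolding RS_criterion_def by blast
    thus "k \<in> interp_vars (toeplitz c) m \<theta> C i" using sd by (simp add: interp_vars_def)
  qed
  hence "interp_FC (toeplitz c) m \<theta> C v i = (\<Sum>k\<in>{i - 1, Suc i} \<inter> {1..m}. v k / 2)"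
    by (simp add: interp_FC_def)
  \<comment> \<open>A neighbour outside the range has value zero in \<open>zero_ext\<close>, so the
    first and last rows fit the same formula.\<close>
  also have "\<dots> = (\<Sum>k\<in>{i - 1, Suc i}. zero_ext m v k / 2)"
    by (rule sum.mono_neutral_cong_left) (auto simp: zero_ext_def)
  also have "\<dots> = (zero_ext m v (i - 1) + zero_ext m v (Suc i)) / 2"
    by (simp add: add_divide_distrib)
  finally show ?thesis .
qed

end

lemma card_neighbours_le: "card {k \<in> {1..m}. \<bar>int i - int k\<bar> = 1} \<le> 2"
proof -
  have "card {k \<in> {1..m}. \<bar>int i - int k\<bar> = 1} \<le> card {i - 1, Suc i}"
    by (intro card_mono) auto
  also have "\<dots> \<le> 2" by (simp add: card_insert_if)
  finally show ?thesis .
qed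

section \<open>Accuracy in the three regimes\<close>

lemma norm_1_power2: "0 \<le> quad A m v \<Longrightarrow> (norm_1 A m v)\<^sup>2 = quad A m v"
  by (simp add: norm_1_def quad_def)

lemma norm_0F_toeplitz_power2:
  "0 \<le> c 0 \<Longrightarrow> (norm_0F (toeplitz c) F x)\<^sup>2 = c 0 * (\<Sum>i\<in>F. (x i)\<^sup>2)"
  by (simp add: norm_0F_def toeplitz_def sum_nonneg sum_distrib_left power2_eq_square mult.assoc)

lemma ex_powr_bound:
  fixes q x y :: real
  assumes "0 < q" "0 < y"
  shows "\<exists>h0>0. \<forall>h. 0 < h \<and> h \<le> h0 \<longrightarrow> h powr q * \<bar>x\<bar> \<le> y"
proof (intro exI conjI allI impI)
  \<comment> \<open>The \<open>+ 1\<close> keeps the quotient meaningful for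
    \<open>x = 0\<close>.\<close>
  let ?h = "(y / (\<bar>x\<bar> + 1)) powr (1 / q)"
  show "0 < ?h" using assms by (simp add: add_nonneg_pos)
  fix h assume h: "0 < h \<and> h \<le> ?h"
  hence "h powr q \<le> ?h powr q" using assms by (intro powr_mono2) auto
  also have "\<dots> = y / (\<bar>x\<bar> + 1)" using assms by (simp add: powr_powr)
  finally have "h powr q * \<bar>x\<bar> \<le> y / (\<bar>x\<bar> + 1) * \<bar>x\<bar>" by (rule mult_right_mono) simp
  also have "\<dots> \<le> y" using assms by (simp add: field_simps)
  finally show "h powr q * \<bar>x\<bar> \<le> y" .
qed

text \<open>Collects what the estimates use about the stencils \<open>u\<close> of order
  \<open>\<beta>\<close> and \<open>g\<close> of order \<open>\<gamma>\<close>. The sign of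
  \<open>u 1\<close> is left open, since it depends on the position of \<open>\<beta>\<close>
  relative to \<open>beta0\<close>. The exponent \<open>q\<close> damps \<open>u\<close> against
  \<open>g\<close>; \<open>q'\<close> measures how small the mass term is for large time
  steps.\<close>

locale stencil_pair =
  fixes u g :: "nat \<Rightarrow> real" and q q' :: real
  assumes u_tail: "\<And>l. 2 \<le> l \<Longrightarrow> u l \<le> 0"
    and u_mono: "\<And>l. 2 \<le> l \<Longrightarrow> u l \<le> u (Suc l)"
    and u_partial: "\<And>k. 0 \<le> u 0 / 2 + (\<Sum>l=1..Suc k. u l)"
    and g_tail: "\<And>l. 2 \<le> l \<Longrightarrow> g l \<le> 0"
    and g_mono: "\<And>l. 2 \<le> l \<Longrightarrow> g l \<le> g (Suc l)"
    and g_partial: "\<And>k. 0 \<le> g 0 / 2 + (\<Sum>l=1..Suc k. g l)"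
    and g1_neg: "g 1 < 0" and g_gap: "g 1 < g 2"
    and q: "0 < q" "0 < q'"
begin

text \<open>\<open>V\<close> contains the time factor and \<open>h powr (1 - 2 * \<gamma>)\<close>,
  so only the relative weight \<open>h powr q\<close> of the lower order stays visible.\<close>

definition entry :: "real \<Rightarrow> real \<Rightarrow> real \<Rightarrow> nat \<Rightarrow> real" where
  "entry S V h l = S * h * (if l = 0 then 2/3 else if l = 1 then 1/6 else 0)
     + V * (h powr q * u l + g l)"

text \<open>Half of \<open>- g 1\<close> is spent on absorbing \<open>u 1\<close>; the other half
  remains in front of the differences.\<close>

lemma entry_energy:
  assumes S: "0 \<le> S" and V: "0 < V" and h: "0 < h" and u1: "h powr q * u 1 \<le> - g 1 / 2"
  shows "S * h / 3 * (\<Sum>i=1..m. (v i)\<^sup>2) + V * (- g 1) / 2 * dirichlet m v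
    \<le> quad (toeplitz (entry S V h)) m v"
proof -
  have partial: "0 \<le> (h powr q * u 0 + g 0) / 2 + (\<Sum>l=1..Suc k. h powr q * u l + g l)" for k
  proof -
    have "0 \<le> h powr q * (u 0 / 2 + (\<Sum>l=1..Suc k. u l)) + (g 0 / 2 + (\<Sum>l=1..Suc k. g l))"
      by (intro add_nonneg_nonneg mult_nonneg_nonneg u_partial g_partial powr_ge_zero)
    also have "\<dots> = (h powr q * u 0 + g 0) / 2 + (\<Sum>l=1..Suc k. h powr q * u l + g l)"
      by (simp only: sum.distrib sum_distrib_left[symmetric]) (simp add: algebra_simps add_divide_distrib)
    finally show ?thesis .
  qed
  have "S * h / 3 * (\<Sum>i=1..m. (v i)\<^sup>2) + V * (- (h powr q * u 1 + g 1)) * dirichlet m v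
    \<le> quad (toeplitz (entry S V h)) m v"
    by (rule quad_toeplitz_lower_bound[where w = "\<lambda>l. h powr q * u l + g l"])
      (use S V h u_tail g_tail partial in \<open>auto simp: entry_def intro!: add_nonpos_nonpos mult_nonneg_nonpos\<close>)
  moreover have "V * (- g 1 / 2) * dirichlet m v \<le> V * (- (h powr q * u 1 + g 1)) * dirichlet m v"
    using u1 V dirichlet_nonneg by (intro mult_right_mono mult_left_mono) auto
  ultimately show ?thesis by simp
qed

text \<open>The upper bound is stated in terms of \<open>S * h / 3\<close> and \<open>V\<close>, the
  two weights of the energy bound.\<close>

lemma entry_diag:
  assumes S: "0 \<le> S" and V: "0 < V" and h: "0 < h" "h \<le> 1" and u1: "h powr q * u 1 \<le> - g 1 / 2"
  shows "0 \<le> entry S V h 0" "entry S V h 0 \<le> 2 * (S * h / 3) + V * (\<bar>u 0\<bar> + \<bar>g 0\<bar>)"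
proof -
  have "0 \<le> h powr q * (u 0 / 2 + u 1) + (g 0 / 2 + g 1)"
    using add_nonneg_nonneg[OF mult_nonneg_nonneg[OF powr_ge_zero[of h q] u_partial[of 0]] g_partial[of 0]] by simp
  hence "0 \<le> h powr q * u 0 + g 0" using u1 g1_neg by (simp add: algebra_simps)
  thus "0 \<le> entry S V h 0" using S V h by (simp add: entry_def)
  have "h powr q \<le> 1" using h q by (intro powr_le1) auto
  have "h powr q * u 0 \<le> h powr q * \<bar>u 0\<bar>" by (intro mult_left_mono) auto
  also have "\<dots> \<le> 1 * \<bar>u 0\<bar>" using \<open>h powr q \<le> 1\<close> by (intro mult_right_mono) auto
  finally have "h powr q * u 0 + g 0 \<le> \<bar>u 0\<bar> + \<bar>g 0\<bar>" by simp
  hence "V * (h powr q * u 0 + g 0) \<le> V * (\<bar>u 0\<bar> + \<bar>g 0\<bar>)"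
    using V by (intro mult_left_mono) auto
  thus "entry S V h 0 \<le> 2 * (S * h / 3) + V * (\<bar>u 0\<bar> + \<bar>g 0\<bar>)"
    by (simp add: entry_def)
qed

lemma entry_tail:
  assumes V: "0 < V" and l: "2 \<le> l"
  shows "entry S V h l \<le> 0" "entry S V h 2 \<le> entry S V h l"
proof -
  have "u 2 \<le> u l" "g 2 \<le> g l"
    using l by (induction l rule: dec_induct) (auto intro: order_trans u_mono g_mono)
  thus "entry S V h 2 \<le> entry S V h l"
    using V l by (auto simp: entry_def intro!: mult_left_mono add_mono)
  show "entry S V h l \<le> 0"
    using V l u_tail[OF l] g_tail[OF l]
    by (auto simp: entry_def intro!: mult_nonneg_nonpos add_nonpos_nonpos)
qed

lemma accuracy_coarse_mesh:
  assumes S: "0 \<le> S" and V: "0 < V" and h: "0 < h" "h \<le> 1" and u1: "h powr q * u 1 \<le> - g 1 / 2"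
    and m: "real m \<le> B" and F: "F \<subseteq> {1..m}"
  shows "entry S V h 0 * (\<Sum>i\<in>F. (v i - interp_FC (toeplitz (entry S V h)) m \<theta> C v i)\<^sup>2)
    \<le> (2 + B\<^sup>2 / 2) * (2 + 2 * (\<bar>u 0\<bar> + \<bar>g 0\<bar>) / (- g 1) * B\<^sup>2) * quad (toeplitz (entry S V h)) m v"
proof -
  define E where "E = (\<Sum>i=1..m. (v i)\<^sup>2)"
  define D where "D = dirichlet m v"
  define Q where "Q = quad (toeplitz (entry S V h)) m v"
  define K where "K = \<bar>u 0\<bar> + \<bar>g 0\<bar>"
  have E0: "0 \<le> E" unfolding E_def by (intro sum_nonneg) auto
  have D0: "0 \<le> D" unfolding D_def by (rule dirichlet_nonneg)
  have mB: "(real m)\<^sup>2 \<le> B\<^sup>2" using m by (intro power_mono) auto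
  have X: "(\<Sum>i\<in>F. (v i - interp_FC (toeplitz (entry S V h)) m \<theta> C v i)\<^sup>2) \<le> (2 + (real m)\<^sup>2 / 2) * E"
    unfolding interp_FC_def E_def
    \<comment> \<open>The trivial relation suffices here, as \<open>m\<close> itself is
      bounded.\<close>
    by (rule sum_half_interp_sq_le[where Q = "\<lambda>_ _. True", OF _ F])
      (auto simp: interp_vars_def strongly_depends_def atLeastAtMost_def[symmetric] simp flip: atLeastAtMost_iff)
  have "E \<le> (real m)\<^sup>2 * D" unfolding E_def D_def by (rule discrete_poincare)
  also have "\<dots> \<le> B\<^sup>2 * D" using mB D0 by (rule mult_right_mono)
  finally have ED: "E \<le> B\<^sup>2 * D" .
  have en: "S * h / 3 * E + V * (- g 1) / 2 * D \<le> Q"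
    unfolding E_def D_def Q_def by (rule entry_energy[OF S V h(1) u1])
  have p: "0 \<le> S * h / 3 * E" "0 \<le> V * (- g 1) / 2 * D"
    using S V h E0 D0 g1_neg by (intro mult_nonneg_nonneg divide_nonneg_pos; simp)+
  have "entry S V h 0 * E \<le> (2 * (S * h / 3) + V * K) * E"
    unfolding K_def using entry_diag(2)[OF S V h u1] E0 by (rule mult_right_mono)
  also have "\<dots> = 2 * (S * h / 3 * E) + V * K * E" by (simp add: algebra_simps)
  also have "V * K * E \<le> V * K * (B\<^sup>2 * D)"
    using ED V by (intro mult_left_mono) (auto simp: K_def)
  also have "V * K * (B\<^sup>2 * D) = 2 * K / (- g 1) * B\<^sup>2 * (V * (- g 1) / 2 * D)"
    using g1_neg by (simp add: field_simps)
  also have "2 * (S * h / 3 * E) + 2 * K / (- g 1) * B\<^sup>2 * (V * (- g 1) / 2 * D)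
      \<le> 2 * Q + 2 * K / (- g 1) * B\<^sup>2 * Q"
    using en p g1_neg by (intro add_mono mult_left_mono) (auto simp: K_def divide_nonneg_neg)
  finally have cE: "entry S V h 0 * E \<le> (2 + 2 * K / (- g 1) * B\<^sup>2) * Q"
    by (simp only: distrib_right)
  have "entry S V h 0 * (\<Sum>i\<in>F. (v i - interp_FC (toeplitz (entry S V h)) m \<theta> C v i)\<^sup>2)
      \<le> entry S V h 0 * ((2 + (real m)\<^sup>2 / 2) * E)"
    using X entry_diag(1)[OF S V h u1] by (rule mult_left_mono)
  also have "\<dots> \<le> entry S V h 0 * ((2 + B\<^sup>2 / 2) * E)"
    using mB E0 entry_diag(1)[OF S V h u1] by (intro mult_left_mono mult_right_mono) auto
  also have "\<dots> = (2 + B\<^sup>2 / 2) * (entry S V h 0 * E)" by simp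
  also have "\<dots> \<le> (2 + B\<^sup>2 / 2) * ((2 + 2 * K / (- g 1) * B\<^sup>2) * Q)"
    using cE by (intro mult_left_mono) (auto simp: add_nonneg_nonneg)
  finally show ?thesis by (simp only: K_def Q_def mult.assoc)
qed

text \<open>\<open>Sh\<close> makes the neighbour entry negative, hence at most two interpolatory
  variables and the factor \<open>2 + 2^2 / 2 = 4\<close>. The lower bound on \<open>S * h\<close>
  converts the stiffness part of the diagonal into mass.\<close>

lemma accuracy_mass_dominated:
  assumes S: "0 \<le> S" and V: "0 < V" and h: "0 < h" "h \<le> 1" and u1: "h powr q * u 1 \<le> - g 1 / 2"
    and Sh: "S * h < 3 * V * (- g 1)" and d: "0 < d" "6 * d * V \<le> S * h" and F: "F \<subseteq> {1..m}"
    and \<theta>: "\<theta> = entry S V h 2 / entry S V h 1 + \<epsilon>" "0 < \<epsilon>"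
  shows "entry S V h 0 * (\<Sum>i\<in>F. (v i - interp_FC (toeplitz (entry S V h)) m \<theta> C v i)\<^sup>2)
    \<le> 4 * (2 + (\<bar>u 0\<bar> + \<bar>g 0\<bar>) / (2 * d)) * quad (toeplitz (entry S V h)) m v"
proof -
  define E where "E = (\<Sum>i=1..m. (v i)\<^sup>2)"
  define Q where "Q = quad (toeplitz (entry S V h)) m v"
  define K where "K = \<bar>u 0\<bar> + \<bar>g 0\<bar>"
  have E0: "0 \<le> E" unfolding E_def by (intro sum_nonneg) auto
  have "V * (h powr q * u 1 + g 1) \<le> V * (g 1 / 2)"
    using V u1 by (intro mult_left_mono) auto
  hence c1: "entry S V h 1 < 0" using Sh by (simp add: entry_def)
  have nb: "\<bar>int i - int k\<bar> = 1" if "strongly_depends (toeplitz (entry S V h)) m \<theta> i k" for i k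
    by (rule strongly_depends_toeplitz_imp_neighbour[OF c1 entry_tail(1)[OF V] entry_tail(2)[OF V] \<theta> that]) auto
  have X: "(\<Sum>i\<in>F. (v i - interp_FC (toeplitz (entry S V h)) m \<theta> C v i)\<^sup>2) \<le> (2 + (real 2)\<^sup>2 / 2) * E"
    unfolding interp_FC_def E_def
    by (rule sum_half_interp_sq_le[where Q = "\<lambda>i k. \<bar>int i - int k\<bar> = 1", OF _ F])
      (use nb card_neighbours_le in \<open>auto simp: interp_vars_def strongly_depends_def abs_minus_commute\<close>)
  have "S * h / 3 * E + V * (- g 1) / 2 * dirichlet m v \<le> Q"
    unfolding E_def Q_def by (rule entry_energy[OF S V h(1) u1])
  moreover have "0 \<le> V * (- g 1) / 2 * dirichlet m v"
    using V g1_neg dirichlet_nonneg[of m v] by (intro mult_nonneg_nonneg divide_nonneg_pos) auto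
  ultimately have en: "S * h / 3 * E \<le> Q" by linarith
  have "V * K \<le> S * h / (6 * d) * K"
    using d by (intro mult_right_mono) (auto simp: K_def field_simps)
  hence "entry S V h 0 \<le> (2 + K / (2 * d)) * (S * h / 3)"
    using entry_diag(2)[OF S V h u1] by (simp add: K_def algebra_simps)
  hence "entry S V h 0 * E \<le> (2 + K / (2 * d)) * (S * h / 3) * E" using E0 by (rule mult_right_mono)
  also have "\<dots> = (2 + K / (2 * d)) * (S * h / 3 * E)" by simp
  also have "\<dots> \<le> (2 + K / (2 * d)) * Q"
    using en d by (intro mult_left_mono) (auto simp: K_def)
  finally have cE: "entry S V h 0 * E \<le> (2 + K / (2 * d)) * Q" .
  have "entry S V h 0 * (\<Sum>i\<in>F. (v i - interp_FC (toeplitz (entry S V h)) m \<theta> C v i)\<^sup>2)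
      \<le> entry S V h 0 * ((2 + (real 2)\<^sup>2 / 2) * E)"
    using X entry_diag(1)[OF S V h u1] by (rule mult_left_mono)
  also have "\<dots> = 4 * (entry S V h 0 * E)" by simp
  also have "\<dots> \<le> 4 * ((2 + K / (2 * d)) * Q)" using cE by simp
  finally show ?thesis by (simp only: K_def Q_def mult.assoc)
qed

text \<open>Here the mass part of the diagonal is at most \<open>4 * d * V\<close>, so the
  differences in the energy alone control the error.\<close>

lemma accuracy_stiffness_dominated:
  assumes S: "0 \<le> S" and V: "0 < V" and h: "0 < h" "h \<le> 1" and u1: "h powr q * u 1 \<le> - g 1 / 2"
    and d: "S * h \<le> 6 * d * V" and c1: "entry S V h 1 < 0"
    and \<theta>: "\<theta> = entry S V h 2 / entry S V h 1 + \<epsilon>" "0 < \<epsilon>" "\<theta> \<le> 1"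
    and CF: "CF_splitting m C F" and RS: "RS_criterion (toeplitz (entry S V h)) m \<theta> C F"
  shows "entry S V h 0 * (\<Sum>i\<in>F. (v i - interp_FC (toeplitz (entry S V h)) m \<theta> C v i)\<^sup>2)
    \<le> 2 * (4 * d + (\<bar>u 0\<bar> + \<bar>g 0\<bar>)) / (- g 1) * quad (toeplitz (entry S V h)) m v"
proof -
  define E where "E = (\<Sum>i=1..m. (v i)\<^sup>2)"
  define D where "D = dirichlet m v"
  define Q where "Q = quad (toeplitz (entry S V h)) m v"
  define K where "K = \<bar>u 0\<bar> + \<bar>g 0\<bar>"
  have D0: "0 \<le> D" unfolding D_def by (rule dirichlet_nonneg)
  have d0: "0 \<le> d" using d S V h mult_nonneg_nonneg[of S h]
    by (smt (verit) mult_neg_pos)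
  have "(\<Sum>i\<in>F. (v i - interp_FC (toeplitz (entry S V h)) m \<theta> C v i)\<^sup>2)
      = (\<Sum>i\<in>F. (v i - (zero_ext m v (i - 1) + zero_ext m v (Suc i)) / 2)\<^sup>2)"
    using interp_FC_toeplitz_eq_average[OF c1 entry_tail(1)[OF V] entry_tail(2)[OF V] \<theta> CF RS]
    by (intro sum.cong refl) (simp only:)
  also have "\<dots> \<le> (\<Sum>i=1..m. (v i - (zero_ext m v (i - 1) + zero_ext m v (Suc i)) / 2)\<^sup>2)"
    using CF by (intro sum_mono2) (auto simp: CF_splitting_def)
  also have "\<dots> \<le> D" unfolding D_def by (rule sum_diff_sq_le_dirichlet)
  finally have X: "(\<Sum>i\<in>F. (v i - interp_FC (toeplitz (entry S V h)) m \<theta> C v i)\<^sup>2) \<le> D" .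
  have "S * h / 3 * E + V * (- g 1) / 2 * D \<le> Q"
    unfolding E_def D_def Q_def by (rule entry_energy[OF S V h(1) u1])
  moreover have "0 \<le> S * h / 3 * E"
    unfolding E_def using S h by (intro mult_nonneg_nonneg sum_nonneg) auto
  ultimately have en: "V * (- g 1) / 2 * D \<le> Q" by linarith
  have "entry S V h 0 \<le> V * (4 * d + K)"
    using entry_diag(2)[OF S V h u1] d by (simp add: K_def algebra_simps)
  hence "entry S V h 0 * D \<le> V * (4 * d + K) * D" using D0 by (rule mult_right_mono)
  also have "\<dots> = 2 * (4 * d + K) / (- g 1) * (V * (- g 1) / 2 * D)"
    using g1_neg by (simp add: field_simps)
  also have "\<dots> \<le> 2 * (4 * d + K) / (- g 1) * Q"
    using en d0 g1_neg by (intro mult_left_mono) (auto simp: K_def divide_nonneg_neg)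
  finally have "entry S V h 0 * D \<le> 2 * (4 * d + K) / (- g 1) * Q" .
  moreover have "entry S V h 0 * (\<Sum>i\<in>F. (v i - interp_FC (toeplitz (entry S V h)) m \<theta> C v i)\<^sup>2)
      \<le> entry S V h 0 * D"
    using X entry_diag(1)[OF S V h u1] by (rule mult_left_mono)
  ultimately show ?thesis unfolding K_def Q_def by linarith
qed

text \<open>Both constants depend only on the stencils, the exponents, \<open>\<Lambda>\<close> and
  \<open>L\<close>. The two alternatives for \<open>S * h\<close> are what the step-size condition
  yields for small and for large time steps.\<close>

lemma accuracy_uniform:
  "\<exists>\<epsilon>max>0. \<exists>\<sigma>\<ge>1. \<forall>S V h \<epsilon> \<theta>. \<forall>m C F v.
     0 \<le> S \<longrightarrow> 0 < V \<longrightarrow> 0 < h \<longrightarrow> h \<le> 1 \<longrightarrow> h powr q * u 1 \<le> - g 1 / 2 \<longrightarrow>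
     S * h < 3 * V * (- g 1) \<or> S * h \<le> \<Lambda> * h powr q' * V \<longrightarrow>
     real m * h \<le> L \<longrightarrow> 0 < \<epsilon> \<longrightarrow> \<epsilon> < \<epsilon>max \<longrightarrow>
     \<theta> = entry S V h 2 / entry S V h 1 + \<epsilon> \<longrightarrow>
     CF_splitting m C F \<longrightarrow> RS_criterion (toeplitz (entry S V h)) m \<theta> C F \<longrightarrow>
     (norm_0F (toeplitz (entry S V h)) F (\<lambda>i. v i - interp_FC (toeplitz (entry S V h)) m \<theta> C v i))\<^sup>2
       \<le> \<sigma> * (norm_1 (toeplitz (entry S V h)) m v)\<^sup>2"
proof -
  \<comment> \<open>A sixth of the gap: perturbations by \<open>2 * d\<close> in the first entry
    (one \<open>d\<close> each from the mass and from \<open>u 1\<close>) and by \<open>d\<close> in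
    the second still leave them \<open>3 * d\<close> apart.\<close>
  define d where "d = (g 2 - g 1) / 6"
  have d0: "0 < d" using g_gap by (simp add: d_def)
  have g2: "g 2 \<le> 0" by (rule g_tail) simp
  have gd: "g 1 + 2 * d < g 2 - d" using g_gap by (simp add: d_def field_simps)
  obtain h1 where h1: "0 < h1" "\<forall>h. 0 < h \<and> h \<le> h1 \<longrightarrow> h powr q * \<bar>u 1\<bar> \<le> d"
    using ex_powr_bound[OF q(1) d0, of "u 1"] by blast
  obtain h2 where h2: "0 < h2" "\<forall>h. 0 < h \<and> h \<le> h2 \<longrightarrow> h powr q * \<bar>u 2\<bar> \<le> d"
    using ex_powr_bound[OF q(1) d0, of "u 2"] by blast
  obtain h3 where h3: "0 < h3" "\<forall>h. 0 < h \<and> h \<le> h3 \<longrightarrow> h powr q' * \<bar>\<Lambda>\<bar> \<le> d"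
    using ex_powr_bound[OF q(2) d0, of \<Lambda>] by blast
  define h0 where "h0 = min h1 (min h2 h3)"
  have h0: "0 < h0" using h1 h2 h3 by (simp add: h0_def)
  \<comment> \<open>Bound for the ratio of the second to the first off-diagonal entry;
    \<open>1 - \<rho>\<close> is the room left for the tolerance.\<close>
  define \<rho> where "\<rho> = (- g 2 + d) / (- g 1 - 2 * d)"
  have \<rho>: "\<rho> < 1" using gd g2 d0 by (simp add: \<rho>_def)
  define B where "B = L / h0"
  define K where "K = \<bar>u 0\<bar> + \<bar>g 0\<bar>"
  define \<sigma>a where "\<sigma>a = (2 + B\<^sup>2 / 2) * (2 + 2 * K / (- g 1) * B\<^sup>2)"
  define \<sigma>b where "\<sigma>b = 4 * (2 + K / (2 * d))"
  define \<sigma>c where "\<sigma>c = 2 * (4 * d + K) / (- g 1)"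
  have K0: "0 \<le> K" by (simp add: K_def)
  have \<sigma>0: "0 \<le> \<sigma>a" "0 \<le> \<sigma>b" "0 \<le> \<sigma>c"
    unfolding \<sigma>a_def \<sigma>b_def \<sigma>c_def using K0 d0 g1_neg
    by (intro mult_nonneg_nonneg add_nonneg_nonneg divide_nonneg_pos zero_le_power2; simp)+
  show ?thesis
  proof (rule exI[of _ "1 - \<rho>"], intro exI[of _ "1 + \<sigma>a + \<sigma>b + \<sigma>c"] conjI allI impI)
    show "0 < 1 - \<rho>" using \<rho> by simp
    show "1 \<le> 1 + \<sigma>a + \<sigma>b + \<sigma>c" using \<sigma>0 by simp
    fix S V h \<epsilon> \<theta> :: real and m :: nat and C F :: "nat set" and v :: "nat \<Rightarrow> real"
    assume S: "0 \<le> S" and V: "0 < V" and h: "0 < h" "h \<le> 1" and u1: "h powr q * u 1 \<le> - g 1 / 2"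
      and mass: "S * h < 3 * V * (- g 1) \<or> S * h \<le> \<Lambda> * h powr q' * V"
      and m: "real m * h \<le> L" and \<epsilon>: "0 < \<epsilon>" "\<epsilon> < 1 - \<rho>"
      and \<theta>: "\<theta> = entry S V h 2 / entry S V h 1 + \<epsilon>"
      and CF: "CF_splitting m C F" and RS: "RS_criterion (toeplitz (entry S V h)) m \<theta> C F"
    define X where "X = entry S V h 0 * (\<Sum>i\<in>F. (v i - interp_FC (toeplitz (entry S V h)) m \<theta> C v i)\<^sup>2)"
    define Q where "Q = quad (toeplitz (entry S V h)) m v"
    have F: "F \<subseteq> {1..m}" using CF by (auto simp: CF_splitting_def)
    have "0 \<le> S * h / 3 * (\<Sum>i=1..m. (v i)\<^sup>2) + V * (- g 1) / 2 * dirichlet m v"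
      using S V h g1_neg dirichlet_nonneg[of m v]
      by (intro add_nonneg_nonneg mult_nonneg_nonneg divide_nonneg_pos sum_nonneg) auto
    also have "\<dots> \<le> Q" unfolding Q_def by (rule entry_energy[OF S V h(1) u1])
    finally have Q0: "0 \<le> Q" .
    have "X \<le> \<sigma>a * Q \<or> X \<le> \<sigma>b * Q \<or> X \<le> \<sigma>c * Q"
    proof (cases "h \<le> h0")
      case False
      have "real m * h0 \<le> real m * h" using False by (intro mult_left_mono) auto
      hence "real m \<le> B" using m h0 by (simp add: B_def field_simps)
      thus ?thesis using accuracy_coarse_mesh[OF S V h u1 _ F, of B v \<theta> C]
        by (simp add: X_def Q_def \<sigma>a_def K_def)
    next
      case True
      have small: "h powr q * \<bar>u 1\<bar> \<le> d" "h powr q * \<bar>u 2\<bar> \<le> d" "h powr q' * \<bar>\<Lambda>\<bar> \<le> d"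
        using True h(1) h1(2) h2(2) h3(2) by (auto simp: h0_def)
      show ?thesis
      proof (cases "6 * d * V \<le> S * h")
        case big: True
        \<comment> \<open>For such small \<open>h\<close> the second alternative would give
          \<open>S * h \<le> d * V\<close>, against \<open>big\<close>; so the first one
          holds.\<close>
        have "\<Lambda> * h powr q' * V \<le> \<bar>\<Lambda>\<bar> * h powr q' * V"
          using V by (intro mult_right_mono) auto
        also have "\<dots> \<le> d * V"
          using small(3) V by (intro mult_right_mono) (auto simp: mult.commute)
        also have "\<dots> < 6 * d * V" using d0 V by simp
        finally have "S * h < 3 * V * (- g 1)" using mass big by linarith
        from accuracy_mass_dominated[OF S V h u1 this d0 big F \<theta> \<epsilon>(1), of v C] show ?thesis
          by (simp add: X_def Q_def \<sigma>b_def K_def)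
      next
        case False
        hence Sh: "S * h \<le> 6 * d * V" by simp
        have "h powr q * u 1 \<le> h powr q * \<bar>u 1\<bar>" by (intro mult_left_mono) auto
        hence "h powr q * u 1 + g 1 \<le> d + g 1" using small(1) by simp
        hence "V * (h powr q * u 1 + g 1) \<le> V * (d + g 1)" using V by (intro mult_left_mono) auto
        hence c1: "V * (- g 1 - 2 * d) \<le> - entry S V h 1"
          using Sh by (simp add: entry_def algebra_simps)
        have "h powr q * - \<bar>u 2\<bar> \<le> h powr q * u 2" by (intro mult_left_mono) auto
        hence "g 2 - d \<le> h powr q * u 2 + g 2" using small(2) by simp
        hence "V * (g 2 - d) \<le> V * (h powr q * u 2 + g 2)" using V by (intro mult_left_mono) auto
        hence c2: "- entry S V h 2 \<le> V * (- g 2 + d)" by (simp add: entry_def algebra_simps)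
        have gpos: "0 < V * (- g 1 - 2 * d)" using V gd g2 d0 by (intro mult_pos_pos) auto
        have "entry S V h 2 / entry S V h 1 = (- entry S V h 2) / (- entry S V h 1)" by simp
        also have "\<dots> \<le> (V * (- g 2 + d)) / (V * (- g 1 - 2 * d))"
          using c1 c2 gpos V g2 d0 by (intro frac_le) auto
        also have "\<dots> = \<rho>" using V by (simp add: \<rho>_def)
        finally have "\<theta> \<le> 1" using \<theta> \<epsilon> by simp
        moreover have "entry S V h 1 < 0" using c1 gpos by linarith
        ultimately show ?thesis
          using accuracy_stiffness_dominated[OF S V h u1 Sh _ \<theta> \<epsilon>(1) _ CF RS, of v]
          by (simp add: X_def Q_def \<sigma>c_def K_def)
      qed
    qed
    moreover have "\<sigma>a * Q \<le> (1 + \<sigma>a + \<sigma>b + \<sigma>c) * Q" "\<sigma>b * Q \<le> (1 + \<sigma>a + \<sigma>b + \<sigma>c) * Q"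
        "\<sigma>c * Q \<le> (1 + \<sigma>a + \<sigma>b + \<sigma>c) * Q"
      using Q0 \<sigma>0 by (intro mult_right_mono; simp)+
    ultimately have "X \<le> (1 + \<sigma>a + \<sigma>b + \<sigma>c) * Q" by linarith
    thus "(norm_0F (toeplitz (entry S V h)) F (\<lambda>i. v i - interp_FC (toeplitz (entry S V h)) m \<theta> C v i))\<^sup>2
       \<le> (1 + \<sigma>a + \<sigma>b + \<sigma>c) * (norm_1 (toeplitz (entry S V h)) m v)\<^sup>2"
      using Q0 entry_diag(1)[OF S V h u1]
      by (simp add: norm_0F_toeplitz_power2 norm_1_power2 X_def Q_def)
  qed
qed

end

section \<open>The coefficient matrix\<close>

lemma stencil_pair_riesz:
  assumes "0 < \<beta>" "\<beta> < 1/2" "1/2 < \<gamma>" "\<gamma> < 1" "0 < K1" "0 < K2"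
  shows "stencil_pair (\<lambda>l. K1 * (riesz_const \<beta> * frac_stencil \<beta> l))
    (\<lambda>l. K2 * (riesz_const \<gamma> * frac_stencil \<gamma> l)) (2 * (\<gamma> - \<beta>)) (2 * \<gamma>)"
proof
  have r: "riesz_const \<gamma> < 0" using assms by (intro riesz_const_neg)
  have partial: "0 \<le> K * (riesz_const \<mu> * frac_stencil \<mu> 0) / 2 + (\<Sum>l=1..Suc k. K * (riesz_const \<mu> * frac_stencil \<mu> l))"
    if "0 < K" "0 < \<mu>" "\<mu> < 1" "\<mu> \<noteq> 1/2" for K \<mu> k
  proof -
    have "0 \<le> K * (riesz_const \<mu> * (frac_stencil \<mu> 0 / 2 + (\<Sum>l=1..Suc k. frac_stencil \<mu> l)))"
      using that riesz_partial_sum_nonneg[of \<mu> k] by (intro mult_nonneg_nonneg[of K]) auto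
    also have "\<dots> = K * (riesz_const \<mu> * frac_stencil \<mu> 0) / 2 + (\<Sum>l=1..Suc k. K * (riesz_const \<mu> * frac_stencil \<mu> l))"
      by (simp only: sum_distrib_left distrib_left times_divide_eq_right)
    finally show ?thesis .
  qed
  show "0 \<le> K1 * (riesz_const \<beta> * frac_stencil \<beta> 0) / 2 + (\<Sum>l=1..Suc k. K1 * (riesz_const \<beta> * frac_stencil \<beta> l))" for k
    using assms by (intro partial) auto
  show "0 \<le> K2 * (riesz_const \<gamma> * frac_stencil \<gamma> 0) / 2 + (\<Sum>l=1..Suc k. K2 * (riesz_const \<gamma> * frac_stencil \<gamma> l))" for k
    using assms by (intro partial) auto
  show "K2 * (riesz_const \<gamma> * frac_stencil \<gamma> 1) < 0"
    using assms r nbr_coeff_pos[of \<gamma>] by (simp add: frac_stencil_def mult_pos_neg mult_neg_pos)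
  \<comment> \<open>The negative \<open>riesz_const \<gamma>\<close> reverses
    \<open>frac_stencil_2_less\<close>.\<close>
  show "K2 * (riesz_const \<gamma> * frac_stencil \<gamma> 1) < K2 * (riesz_const \<gamma> * frac_stencil \<gamma> 2)"
    using assms r frac_stencil_2_less[of \<gamma>] by (intro mult_strict_left_mono mult_strict_left_mono_neg) auto
next
  fix l :: nat assume l: "2 \<le> l"
  show "K1 * (riesz_const \<beta> * frac_stencil \<beta> l) \<le> 0"
    using assms riesz_tail_nonpos[of \<beta> l] l by (intro mult_nonneg_nonpos[of K1]) auto
  show "K2 * (riesz_const \<gamma> * frac_stencil \<gamma> l) \<le> 0"
    using assms riesz_tail_nonpos[of \<gamma> l] l by (intro mult_nonneg_nonpos[of K2]) auto
  show "K1 * (riesz_const \<beta> * frac_stencil \<beta> l) \<le> K1 * (riesz_const \<beta> * frac_stencil \<beta> (Suc l))"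
    using assms riesz_tail_mono[of \<beta> l] l by (intro mult_left_mono[of _ _ K1]) auto
  show "K2 * (riesz_const \<gamma> * frac_stencil \<gamma> l) \<le> K2 * (riesz_const \<gamma> * frac_stencil \<gamma> (Suc l))"
    using assms riesz_tail_mono[of \<gamma> l] l by (intro mult_left_mono[of _ _ K2]) auto
qed (use assms in auto)

lemma toeplitz_of_abs_diff:
  "(\<And>i j. A i j = c (nat \<bar>int i - int j\<bar>)) \<Longrightarrow> A = toeplitz c"
  by (simp add: toeplitz_def fun_eq_iff)

lemma coeff_matrix_eq_toeplitz:
  assumes "0 < h"
  shows "coeff_matrix s \<alpha> a \<beta> \<gamma> K1 K2 \<tau> h = toeplitz (\<lambda>l.
    (\<Sum>r=0..s. a r * (Gamma (3 - \<alpha> 0) * \<tau> powr (\<alpha> 0 - \<alpha> r) / Gamma (3 - \<alpha> r))) * h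
        * (if l = 0 then 2/3 else if l = 1 then 1/6 else 0)
     + Gamma (3 - \<alpha> 0) * \<tau> powr \<alpha> 0 / 2 * h powr (1 - 2 * \<gamma>)
        * (h powr (2 * (\<gamma> - \<beta>)) * (K1 * (riesz_const \<beta> * frac_stencil \<beta> l))
           + K2 * (riesz_const \<gamma> * frac_stencil \<gamma> l)))"
proof (rule toeplitz_of_abs_diff)
  fix i j :: nat
  define l where "l = nat \<bar>int i - int j\<bar>"
  have m: "mass h i j = h * (if l = 0 then 2/3 else if l = 1 then 1/6 else 0)"
    by (auto simp: mass_def l_def)
  have "h powr (1 - 2 * \<beta>) = h powr ((1 - 2 * \<gamma>) + 2 * (\<gamma> - \<beta>))" by (simp add: algebra_simps)
  also have "\<dots> = h powr (1 - 2 * \<gamma>) * h powr (2 * (\<gamma> - \<beta>))" by (rule powr_add)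
  finally have b: "frac_stiffness \<beta> h i j
      = h powr (1 - 2 * \<gamma>) * h powr (2 * (\<gamma> - \<beta>)) * (riesz_const \<beta> * frac_stencil \<beta> l)"
    by (simp add: frac_stiffness_def riesz_const_def l_def)
  have g: "frac_stiffness \<gamma> h i j = h powr (1 - 2 * \<gamma>) * (riesz_const \<gamma> * frac_stencil \<gamma> l)"
    by (simp add: frac_stiffness_def riesz_const_def l_def)
  show "coeff_matrix s \<alpha> a \<beta> \<gamma> K1 K2 \<tau> h i j =
    (\<Sum>r=0..s. a r * (Gamma (3 - \<alpha> 0) * \<tau> powr (\<alpha> 0 - \<alpha> r) / Gamma (3 - \<alpha> r))) * h
        * (if nat \<bar>int i - int j\<bar> = 0 then 2/3 else if nat \<bar>int i - int j\<bar> = 1 then 1/6 else 0)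
     + Gamma (3 - \<alpha> 0) * \<tau> powr \<alpha> 0 / 2 * h powr (1 - 2 * \<gamma>)
        * (h powr (2 * (\<gamma> - \<beta>)) * (K1 * (riesz_const \<beta> * frac_stencil \<beta> (nat \<bar>int i - int j\<bar>)))
           + K2 * (riesz_const \<gamma> * frac_stencil \<gamma> (nat \<bar>int i - int j\<bar>)))"
    unfolding coeff_matrix_def m b g l_def[symmetric] by (simp add: algebra_simps)
qed

text \<open>The exponents \<open>\<alpha> 0 - \<alpha> r\<close> lie between 0 and
  \<open>\<alpha> 0\<close>, so each power is dominated by one of the two endpoint powers.\<close>

lemma weighted_sum_powr_le:
  fixes \<alpha> a :: "nat \<Rightarrow> real"
  assumes \<alpha>: "\<And>r. r \<le> s \<Longrightarrow> 0 < \<alpha> r \<and> \<alpha> r \<le> \<alpha> 0" "\<alpha> 0 < 1"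
    and a: "\<And>r. r \<le> s \<Longrightarrow> 0 \<le> a r" and \<tau>: "0 < \<tau>"
  shows "(\<Sum>r=0..s. a r * (Gamma (3 - \<alpha> 0) * \<tau> powr (\<alpha> 0 - \<alpha> r) / Gamma (3 - \<alpha> r)))
    \<le> Gamma (3 - \<alpha> 0) * max 1 (\<tau> powr \<alpha> 0) * (\<Sum>r=0..s. a r / Gamma (3 - \<alpha> r))"
  unfolding sum_distrib_left
proof (rule sum_mono)
  fix r assume "r \<in> {0..s}"
  hence r: "r \<le> s" by simp
  have G: "0 < Gamma (3 - \<alpha> r)" "0 < Gamma (3 - \<alpha> 0)" using \<alpha>(1)[OF r] \<alpha>(2) by auto
  have "\<tau> powr (\<alpha> 0 - \<alpha> r) \<le> max 1 (\<tau> powr \<alpha> 0)"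
  proof (cases "\<tau> \<le> 1")
    case True
    hence "\<tau> powr (\<alpha> 0 - \<alpha> r) \<le> 1" using \<tau> \<alpha>(1)[OF r] by (intro powr_le1) auto
    thus ?thesis by simp
  next
    case False
    hence "\<tau> powr (\<alpha> 0 - \<alpha> r) \<le> \<tau> powr \<alpha> 0" using \<alpha>(1)[OF r] by (intro powr_mono) auto
    thus ?thesis by simp
  qed
  hence "a r * (Gamma (3 - \<alpha> 0) * \<tau> powr (\<alpha> 0 - \<alpha> r) / Gamma (3 - \<alpha> r))
      \<le> a r * (Gamma (3 - \<alpha> 0) * max 1 (\<tau> powr \<alpha> 0) / Gamma (3 - \<alpha> r))"
    using G a[OF r] by (intro mult_left_mono divide_right_mono) auto
  thus "a r * (Gamma (3 - \<alpha> 0) * \<tau> powr (\<alpha> 0 - \<alpha> r) / Gamma (3 - \<alpha> r))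
      \<le> Gamma (3 - \<alpha> 0) * max 1 (\<tau> powr \<alpha> 0) * (a r / Gamma (3 - \<alpha> r))"
    by (simp add: mult_ac)
qed

text \<open>\<open>\<epsilon>max\<close> makes precise how small the tolerance has to be. It and
  \<open>\<sigma>2\<close> are chosen before meshes, splittings and vectors, which expresses
  independence of the step sizes.\<close>

theorem theorem5:
  fixes s :: nat and \<alpha> a :: "nat \<Rightarrow> real"
    and \<beta> \<gamma> K1 K2 lo hi T :: real
  assumes "0 < \<alpha> s" and "\<forall>i<s. \<alpha> (Suc i) < \<alpha> i" and "\<alpha> 0 < 1"
    and "0 < \<beta>" "\<beta> < 1/2" and "1/2 < \<gamma>" "\<gamma> < 1"
    and "0 < a 0" and "\<forall>i\<in>{1..s}. 0 \<le> a i"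
    and "0 < K1" and "0 < K2"
    and "lo < hi"
  shows "\<exists>\<epsilon>max>0. \<exists>\<sigma>2\<ge>1. \<forall>M N n :: nat. \<forall>t :: nat \<Rightarrow> real. \<forall>\<tau> h \<epsilon>0 \<theta> :: real.
    \<forall>A :: nat \<Rightarrow> nat \<Rightarrow> real. \<forall>C F :: nat set.
      1 \<le> M \<longrightarrow> h = (hi - lo) / real M \<longrightarrow> h \<le> 1/7 \<longrightarrow>
      temporal_mesh T N t \<longrightarrow> n \<in> {1..N} \<longrightarrow> \<tau> = t n - t (n - 1) \<longrightarrow>
      A = coeff_matrix s \<alpha> a \<beta> \<gamma> K1 K2 \<tau> h \<longrightarrow>
      0 < \<epsilon>0 \<longrightarrow> \<epsilon>0 < \<epsilon>max \<longrightarrow> \<theta> = A 1 3 / A 1 2 + \<epsilon>0 \<longrightarrow>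
      CF_splitting (M - 1) C F \<longrightarrow> RS_criterion A (M - 1) \<theta> C F \<longrightarrow>
      (\<beta> \<ge> beta0 \<or>
       \<beta> < beta0 \<and>
       h powr (2 * (\<gamma> - \<beta>)) <
         - (1/2) * (K2 * nbr_coeff \<gamma> / (cos (\<gamma> * pi) * Gamma (4 - 2 * \<gamma>)))
                 * (cos (\<beta> * pi) * Gamma (4 - 2 * \<beta>) / (K1 * nbr_coeff \<beta>))) \<longrightarrow>
      \<tau> powr \<alpha> 0 / h powr (2 * \<gamma>) >
        - (4 * cos (\<gamma> * pi) * Gamma (4 - 2 * \<gamma>) / (3 * K2 * nbr_coeff \<gamma>))
          * (\<Sum>i=0..s. a i / Gamma (3 - \<alpha> i)) \<longrightarrow>
      (\<forall>e :: nat \<Rightarrow> real.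
        (norm_0F A F (\<lambda>i. e i - interp_FC A (M - 1) \<theta> C e i))\<^sup>2 \<le> \<sigma>2 * (norm_1 A (M - 1) e)\<^sup>2)"
proof -
  define \<Sigma> where "\<Sigma> = (\<Sum>i=0..s. a i / Gamma (3 - \<alpha> i))"
  define u where "u l = K1 * (riesz_const \<beta> * frac_stencil \<beta> l)" for l
  define g where "g l = K2 * (riesz_const \<gamma> * frac_stencil \<gamma> l)" for l
  define W where "W \<tau> = Gamma (3 - \<alpha> 0) * \<tau> powr \<alpha> 0 / 2" for \<tau>
  define S where "S \<tau> = (\<Sum>r=0..s. a r * (Gamma (3 - \<alpha> 0) * \<tau> powr (\<alpha> 0 - \<alpha> r) / Gamma (3 - \<alpha> r)))" for \<tau>
  interpret stencil_pair u g "2 * (\<gamma> - \<beta>)" "2 * \<gamma>"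
    unfolding u_def[abs_def] g_def[abs_def] using assms by (intro stencil_pair_riesz) auto
  have decr: "\<alpha> j \<le> \<alpha> i" if "i \<le> j" "j \<le> s" for i j
    using that
  proof (induction j rule: dec_induct)
    case (step n)
    hence "\<alpha> n \<le> \<alpha> i" "\<alpha> (Suc n) < \<alpha> n" using assms(2) by auto
    thus ?case by linarith
  qed simp
  have \<alpha>: "0 < \<alpha> r \<and> \<alpha> r \<le> \<alpha> 0" if "r \<le> s" for r
    using decr[of r s] decr[of 0 r] that assms(1) by auto
  have \<Gamma>: "0 < Gamma (3 - \<alpha> r)" if "r \<le> s" for r using \<alpha>[OF that] assms(3) by auto
  have a: "0 \<le> a r" if "r \<le> s" for r using assms(8,9) that by (cases "r = 0") auto
  have A: "coeff_matrix s \<alpha> a \<beta> \<gamma> K1 K2 \<tau> h = toeplitz (entry (S \<tau>) (W \<tau> * h powr (1 - 2 * \<gamma>)) h)"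
    if "0 < h" for \<tau> h
    unfolding coeff_matrix_eq_toeplitz[OF that]
    by (rule arg_cong[of _ _ toeplitz]) (intro ext, unfold entry_def S_def W_def u_def g_def, rule refl)
  have S0: "0 \<le> S \<tau>" for \<tau>
    unfolding S_def using a \<Gamma> by (intro sum_nonneg mult_nonneg_nonneg divide_nonneg_pos) (auto intro: less_imp_le)
  have W0: "0 < W \<tau>" if "0 < \<tau>" for \<tau> unfolding W_def using \<Gamma>[of 0] that by simp
  have u1: "u 1 = K1 * riesz_const \<beta> * nbr_coeff \<beta>" and g1: "g 1 = K2 * riesz_const \<gamma> * nbr_coeff \<gamma>"
    by (simp_all add: u_def g_def frac_stencil_def)
  have S_le: "S \<tau> \<le> Gamma (3 - \<alpha> 0) * max 1 (\<tau> powr \<alpha> 0) * \<Sigma>" if "0 < \<tau>" for \<tau>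
    unfolding S_def \<Sigma>_def using \<alpha> assms(3) a that by (rule weighted_sum_powr_le)
  \<comment> \<open>If \<open>u 1\<close> is positive, then \<open>\<beta> < beta0\<close> and the
    condition on \<open>h\<close> reads
    \<open>h powr (2 * (\<gamma> - \<beta>)) < - g 1 / (2 * u 1)\<close>; otherwise the left side is
    nonpositive.\<close>
  have cond: "h powr (2 * (\<gamma> - \<beta>)) * u 1 \<le> - g 1 / 2"
    if h: "0 < h" and cls: "\<beta> \<ge> beta0 \<or>
       \<beta> < beta0 \<and>
       h powr (2 * (\<gamma> - \<beta>)) <
         - (1/2) * (K2 * nbr_coeff \<gamma> / (cos (\<gamma> * pi) * Gamma (4 - 2 * \<gamma>)))
                 * (cos (\<beta> * pi) * Gamma (4 - 2 * \<beta>) / (K1 * nbr_coeff \<beta>))" for h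
  proof (cases "u 1 \<le> 0")
    case True
    hence "h powr (2 * (\<gamma> - \<beta>)) * u 1 \<le> 0" by (intro mult_nonneg_nonpos) auto
    thus ?thesis using g1_neg by simp
  next
    case False
    have "0 < K1 * riesz_const \<beta>" using assms by (simp add: riesz_const_pos)
    hence "\<not> nbr_coeff \<beta> \<le> 0" using False unfolding u1 by (auto simp: mult_nonneg_nonpos)
    hence "\<not> beta0 \<le> \<beta>" using nbr_coeff_nonpos assms by blast
    with cls have "h powr (2 * (\<gamma> - \<beta>)) <
         - (1/2) * (K2 * nbr_coeff \<gamma> / (cos (\<gamma> * pi) * Gamma (4 - 2 * \<gamma>)))
                 * (cos (\<beta> * pi) * Gamma (4 - 2 * \<beta>) / (K1 * nbr_coeff \<beta>))" by blast
    also have "K2 * nbr_coeff \<gamma> / (cos (\<gamma> * pi) * Gamma (4 - 2 * \<gamma>)) = 2 * g 1"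
      unfolding g1 riesz_const_def by simp
    also have "cos (\<beta> * pi) * Gamma (4 - 2 * \<beta>) / (K1 * nbr_coeff \<beta>) = 1 / (2 * u 1)"
      unfolding u1 riesz_const_def by simp
    finally show ?thesis using False by (simp add: field_simps)
  qed
  \<comment> \<open>\<open>(\<ast>)\<close> omits the factors \<open>\<tau> powr (\<alpha> 0 - \<alpha> r)\<close>, so it bounds the mass term only for \<open>\<tau> \<le> 1\<close>; for larger
    \<open>\<tau>\<close> these factors are at most \<open>\<tau> powr \<alpha> 0\<close>, which makes the mass term negligible for small \<open>h\<close>.\<close>
  have mass: "S \<tau> * h < 3 * (W \<tau> * h powr (1 - 2 * \<gamma>)) * (- g 1)
      \<or> S \<tau> * h \<le> 2 * \<Sigma> * h powr (2 * \<gamma>) * (W \<tau> * h powr (1 - 2 * \<gamma>))"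
    if h: "0 < h" and \<tau>: "0 < \<tau>"
      and star: "\<tau> powr \<alpha> 0 / h powr (2 * \<gamma>) >
        - (4 * cos (\<gamma> * pi) * Gamma (4 - 2 * \<gamma>) / (3 * K2 * nbr_coeff \<gamma>)) * \<Sigma>" for \<tau> h
  proof (cases "\<tau> \<le> 1")
    case True
    have "\<tau> powr \<alpha> 0 \<le> 1" using True \<tau> \<alpha>[of 0] by (intro powr_le1) auto
    hence S: "S \<tau> \<le> Gamma (3 - \<alpha> 0) * \<Sigma>"
      using S_le[OF \<tau>] by (simp add: max_absorb1)
    \<comment> \<open>In terms of \<open>g 1\<close> the step-size condition bounds
      \<open>\<Sigma>\<close> by \<open>3 * (- g 1) / 2\<close> times the step-size ratio.\<close>
    have "4 * cos (\<gamma> * pi) * Gamma (4 - 2 * \<gamma>) / (3 * K2 * nbr_coeff \<gamma>) = 2 / (3 * g 1)"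
      unfolding g1 riesz_const_def by simp
    hence "\<Sigma> < 3 * (- g 1) / 2 * (\<tau> powr \<alpha> 0 / h powr (2 * \<gamma>))"
      using star g1_neg by (simp add: field_simps)
    hence "Gamma (3 - \<alpha> 0) * h * \<Sigma> < Gamma (3 - \<alpha> 0) * h * (3 * (- g 1) / 2 * (\<tau> powr \<alpha> 0 / h powr (2 * \<gamma>)))"
      using h \<Gamma>[of 0] by (intro mult_strict_left_mono) auto
    also have "\<dots> = 3 * (W \<tau> * h powr (1 - 2 * \<gamma>)) * (- g 1)"
      using h by (simp add: W_def powr_diff)
    finally have "Gamma (3 - \<alpha> 0) * h * \<Sigma> < 3 * (W \<tau> * h powr (1 - 2 * \<gamma>)) * (- g 1)" .
    moreover have "S \<tau> * h \<le> Gamma (3 - \<alpha> 0) * h * \<Sigma>"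
      using mult_right_mono[OF S, of h] h by (simp add: mult_ac)
    ultimately show ?thesis by linarith
  next
    case False
    hence "1 \<le> \<tau> powr \<alpha> 0" using \<alpha>[of 0] by (intro ge_one_powr_ge_zero) auto
    hence "S \<tau> \<le> 2 * \<Sigma> * W \<tau>"
      using S_le[OF \<tau>] by (simp add: W_def max_absorb2 mult_ac)
    hence "S \<tau> * h \<le> 2 * \<Sigma> * W \<tau> * h" using h by (intro mult_right_mono) auto
    also have "\<dots> = 2 * \<Sigma> * h powr (2 * \<gamma>) * (W \<tau> * h powr (1 - 2 * \<gamma>))"
      using h by (simp add: powr_diff)
    finally show ?thesis by simp
  qed
  \<comment> \<open>\<open>2 * \<Sigma>\<close> comes from the case \<open>\<tau> > 1\<close> above,
    and \<open>hi - lo\<close> bounds \<open>(M - 1) * h\<close>.\<close>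
  from accuracy_uniform[of "2 * \<Sigma>" "hi - lo"] obtain \<epsilon>max \<sigma> where \<epsilon>max: "0 < \<epsilon>max" and \<sigma>: "1 \<le> \<sigma>"
    and main: "\<And>S V h \<epsilon> \<theta> m C F v. 0 \<le> S \<Longrightarrow> 0 < V \<Longrightarrow> 0 < h \<Longrightarrow> h \<le> 1 \<Longrightarrow>
     h powr (2 * (\<gamma> - \<beta>)) * u 1 \<le> - g 1 / 2 \<Longrightarrow>
     S * h < 3 * V * (- g 1) \<or> S * h \<le> 2 * \<Sigma> * h powr (2 * \<gamma>) * V \<Longrightarrow>
     real m * h \<le> hi - lo \<Longrightarrow> 0 < \<epsilon> \<Longrightarrow> \<epsilon> < \<epsilon>max \<Longrightarrow>
     \<theta> = entry S V h 2 / entry S V h 1 + \<epsilon> \<Longrightarrow>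
     CF_splitting m C F \<Longrightarrow> RS_criterion (toeplitz (entry S V h)) m \<theta> C F \<Longrightarrow>
     (norm_0F (toeplitz (entry S V h)) F (\<lambda>i. v i - interp_FC (toeplitz (entry S V h)) m \<theta> C v i))\<^sup>2
       \<le> \<sigma> * (norm_1 (toeplitz (entry S V h)) m v)\<^sup>2"
    by (elim exE conjE) (rule that; blast)
  show ?thesis
  proof (rule exI[of _ \<epsilon>max], intro conjI exI[of _ \<sigma>] allI impI \<epsilon>max \<sigma>)
    fix M N n :: nat and t :: "nat \<Rightarrow> real" and \<tau> h \<epsilon>0 \<theta> :: real
      and A :: "nat \<Rightarrow> nat \<Rightarrow> real" and C F :: "nat set" and e :: "nat \<Rightarrow> real"
    assume M: "1 \<le> M" and h_eq: "h = (hi - lo) / real M" and h7: "h \<le> 1/7"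
      and mesh: "temporal_mesh T N t" and n: "n \<in> {1..N}" and \<tau>_eq: "\<tau> = t n - t (n - 1)"
      and A_eq: "A = coeff_matrix s \<alpha> a \<beta> \<gamma> K1 K2 \<tau> h"
      and \<epsilon>0: "0 < \<epsilon>0" "\<epsilon>0 < \<epsilon>max" and \<theta>: "\<theta> = A 1 3 / A 1 2 + \<epsilon>0"
      and CF: "CF_splitting (M - 1) C F" and RS: "RS_criterion A (M - 1) \<theta> C F"
      and cls: "\<beta> \<ge> beta0 \<or>
       \<beta> < beta0 \<and>
       h powr (2 * (\<gamma> - \<beta>)) <
         - (1/2) * (K2 * nbr_coeff \<gamma> / (cos (\<gamma> * pi) * Gamma (4 - 2 * \<gamma>)))
                 * (cos (\<beta> * pi) * Gamma (4 - 2 * \<beta>) / (K1 * nbr_coeff \<beta>))"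
      and star: "\<tau> powr \<alpha> 0 / h powr (2 * \<gamma>) >
        - (4 * cos (\<gamma> * pi) * Gamma (4 - 2 * \<gamma>) / (3 * K2 * nbr_coeff \<gamma>))
          * (\<Sum>i=0..s. a i / Gamma (3 - \<alpha> i))"
    have h: "0 < h" using h_eq M assms by simp
    have \<tau>: "0 < \<tau>" using mesh n \<tau>_eq by (simp add: temporal_mesh_def)
    have V: "0 < W \<tau> * h powr (1 - 2 * \<gamma>)" using W0[OF \<tau>] h by simp
    have AT: "A = toeplitz (entry (S \<tau>) (W \<tau> * h powr (1 - 2 * \<gamma>)) h)"
      unfolding A_eq by (rule A[OF h])
    have "A 1 3 = entry (S \<tau>) (W \<tau> * h powr (1 - 2 * \<gamma>)) h 2"
      "A 1 2 = entry (S \<tau>) (W \<tau> * h powr (1 - 2 * \<gamma>)) h 1"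
      unfolding AT by (simp_all add: toeplitz_def)
    hence \<theta>': "\<theta> = entry (S \<tau>) (W \<tau> * h powr (1 - 2 * \<gamma>)) h 2
        / entry (S \<tau>) (W \<tau> * h powr (1 - 2 * \<gamma>)) h 1 + \<epsilon>0"
      using \<theta> by simp
    have mh: "real (M - 1) * h \<le> hi - lo"
    proof -
      have "real (M - 1) * h \<le> real M * h" using h by (intro mult_right_mono) auto
      also have "\<dots> = hi - lo" using h_eq M by simp
      finally show ?thesis .
    qed
    show "(norm_0F A F (\<lambda>i. e i - interp_FC A (M - 1) \<theta> C e i))\<^sup>2 \<le> \<sigma> * (norm_1 A (M - 1) e)\<^sup>2"
      unfolding AT
      by (rule main[OF S0 V h _ cond[OF h cls] mass[OF h \<tau> star[folded \<Sigma>_def]] mh \<epsilon>0 \<theta>' CF RS[unfolded AT]])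
        (use h7 in simp)
  qed
qed

end
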